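(* Let $f$ be the symbol of a symmetric tridiagonal $k$-Toeplitz operator $\mathbf{T}(f)$. Then the following hold. (i) If $\lambda\in\sigma(\mathbf{B}_0)\setminus\Gamma$, then there exist $z(\lambda)\in\mathbb{C}\setminus\{0\}$ and a nonzero vector $\mathbf{v}\in\mathbb{C}^k$ such that $\big[f(z(\lambda))-\lambda\,\mathrm{Id}\big]\mathbf{v}=0$ and $\mathbf{v}_k=0$. (ii) If $\lambda\in\sigma(\mathbf{B}_0)\setminus\Gamma$ and a $z(\lambda)$ as in (i) satisfies $|z(\lambda)|>1$, then $\lambda\in\sigma_{\mathrm{edge}}(\mathbf{T}(f))\subseteq\sigma(\mathbf{T}(f))$. (iii) $\sigma(\mathbf{T}(f))=\sigma_{\mathrm{det}}(f)\cup\sigma_{\mathrm{edge}}(\mathbf{T}(f))$.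
   Context: Let $k\ge 1$, $a_1,\dots,a_k\in\mathbb{C}$ and $b_1,\dots,b_k\in\mathbb{C}\setminus\{0\}$, extended $k$-periodically in the index. The symmetric (not necessarily Hermitian) tridiagonal $k$-Toeplitz operator $\mathbf{T}(f)$ on $\ell^2(\mathbb{N})$, $\mathbb{N}=\{1,2,\dots\}$, has matrix entries $\mathbf{T}(f)_{n,n}=a_n$, $\mathbf{T}(f)_{n,n+1}=\mathbf{T}(f)_{n+1,n}=b_n$, and all other entries zero. Its symbol is $f(z)=\mathbf{A}_{-1}z^{-1}+\mathbf{A}_0+\mathbf{A}_1z\in\mathbb{C}^{k\times k}$, $z\in\mathbb{C}\setminus\{0\}$, where $\mathbf{A}_0$ is the leading $k\times k$ block of $\mathbf{T}(f)$, $\mathbf{A}_{-1}$ has the single nonzero entry $b_k$ in position $(k,1)$, and $\mathbf{A}_1$ has the single nonzero entry $b_k$ in position $(1,k)$. $\mathbf{B}_0$ is the leading $(k-1)\times(k-1)$ principal submatrix of $\mathbf{A}_0$ (with $\sigma(\mathbf{B}_0)=\emptyset$ if $k=1$). With $\mathbb{T}$ the unit circle, $\sigma_{\mathrm{det}}(f)=\{\lambda\in\mathbb{C}:\det(f(z)-\lambda)=0\text{ for some }z\in\mathbb{T}\}$. For $\lambda\in\mathbb{C}$ let $z_1(\lambda),z_2(\lambda)$ be the two roots of the quadratic polynomial $z\det(f(z)-\lambda\,\mathrm{Id})$ in $z$, and $\Gamma=\{\lambda\in\mathbb{C}:|z_1(\lambda)|=|z_2(\lambda)|\}$. $\sigma_{\mathrm{ess}}$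 denotes the essential spectrum (the set of $\lambda$ for which the operator minus $\lambda$ is not Fredholm). A number $\lambda\in\mathbb{C}\setminus\sigma_{\mathrm{ess}}(\mathbf{T}(f))$ is an edge eigenvalue of $\mathbf{T}(f)$ if there is $\mathbf{v}\in\ell^2(\mathbb{N})\setminus\{0\}$, with $|\mathbf{v}_n|$ decaying exponentially as $n\to\infty$, such that $\mathbf{T}(f)\mathbf{v}=\lambda\mathbf{v}$. $\sigma_{\mathrm{edge}}(\mathbf{T}(f))$ is the set of edge eigenvalues. *)

theory Defs
  imports
    "HOL-Analysis.Inner_Product"
    "HOL-Computational_Algebra.Fundamental_Theorem_Algebra"
    "Jordan_Normal_Form.Spectral_Radius"
begin

text \<open>
  All indices are shifted by one with respect to the usual mathematical convention: sequences are
  indexed by \<open>0, 1, 2, \<dots>\<close> instead of \<open>1, 2, 3, \<dots>\<close>. The coefficients \<open>a\<^sub>1, \<dots>, a\<^sub>k\<close> and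
  \<open>b\<^sub>1, \<dots>, b\<^sub>k\<close> are the values \<open>a 0, \<dots>, a (k - 1)\<close> and \<open>b 0, \<dots>, b (k - 1)\<close>; the other values
  of \<open>a\<close> and \<open>b\<close> are never used.
\<close>

typedef ell2 = "{v :: nat \<Rightarrow> complex. summable (\<lambda>n. (norm (v n))\<^sup>2)}"
  morphisms ell2_nth Abs_ell2
  by (rule exI[of _ "\<lambda>_. 0"]) simp

setup_lifting type_definition_ell2

lemma ell2_summable: "summable (\<lambda>n. (norm (ell2_nth v n))\<^sup>2)"
  using ell2_nth[of v] by simp

lemma norm_add_sq_le: "(norm (x + y :: complex))\<^sup>2 \<le> 2 * (norm x)\<^sup>2 + 2 * (norm y)\<^sup>2"
proof -
  have "(norm (x + y))\<^sup>2 \<le> (norm x + norm y)\<^sup>2"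
    by (intro power_mono norm_triangle_ineq) auto
  also have "\<dots> \<le> 2 * (norm x)\<^sup>2 + 2 * (norm y)\<^sup>2"
    using zero_le_power2[of "norm x - norm y"] by (simp add: power2_eq_square algebra_simps)
  finally show ?thesis .
qed

lemma sq_summable_add:
  fixes v w :: "nat \<Rightarrow> complex"
  assumes "summable (\<lambda>n. (norm (v n))\<^sup>2)" "summable (\<lambda>n. (norm (w n))\<^sup>2)"
  shows "summable (\<lambda>n. (norm (v n + w n))\<^sup>2)"
  by (rule summable_comparison_test'[where N = 0 and g = "\<lambda>n. 2 * (norm (v n))\<^sup>2 + 2 * (norm (w n))\<^sup>2"])
    (use assms norm_add_sq_le in \<open>auto intro!: summable_add summable_mult\<close>)

lemma sq_summable_mult:
  fixes c v :: "nat \<Rightarrow> complex"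
  assumes "summable (\<lambda>n. (norm (v n))\<^sup>2)" and "\<And>n. norm (c n) \<le> C"
  shows "summable (\<lambda>n. (norm (c n * v n))\<^sup>2)"
proof (rule summable_comparison_test'[where N = 0 and g = "\<lambda>n. C\<^sup>2 * (norm (v n))\<^sup>2"])
  show "summable (\<lambda>n. C\<^sup>2 * (norm (v n))\<^sup>2)"
    using assms(1) by (rule summable_mult)
  show "norm ((norm (c n * v n))\<^sup>2) \<le> C\<^sup>2 * (norm (v n))\<^sup>2" for n
    using assms(2)[of n] by (auto simp: norm_mult power_mult_distrib intro!: mult_right_mono power_mono)
qed

lift_definition scaleC_ell2 :: "complex \<Rightarrow> ell2 \<Rightarrow> ell2" is "\<lambda>c v n. c * v n"
  using sq_summable_mult by fastforce

instantiation ell2 :: real_vector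
begin

lift_definition zero_ell2 :: ell2 is "\<lambda>_. 0" by simp
lift_definition plus_ell2 :: "ell2 \<Rightarrow> ell2 \<Rightarrow> ell2" is "\<lambda>v w n. v n + w n"
  by (simp add: sq_summable_add)
lift_definition uminus_ell2 :: "ell2 \<Rightarrow> ell2" is "\<lambda>v n. - v n" by simp
lift_definition minus_ell2 :: "ell2 \<Rightarrow> ell2 \<Rightarrow> ell2" is "\<lambda>v w n. v n - w n"
  using sq_summable_add[where w = "\<lambda>n. - w n" for w] by fastforce
lift_definition scaleR_ell2 :: "real \<Rightarrow> ell2 \<Rightarrow> ell2" is "\<lambda>r v n. r *\<^sub>R v n"
  by (simp add: power_mult_distrib summable_mult)

instance
  by standard (transfer; auto simp: fun_eq_iff algebra_simps scaleR_conv_of_real)+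

end

lemma ell2_inner_summable: "summable (\<lambda>n. inner (ell2_nth v n) (ell2_nth w n))"
proof (rule summable_comparison_test'[where N = 0 and
        g = "\<lambda>n. (norm (ell2_nth v n))\<^sup>2 + (norm (ell2_nth w n))\<^sup>2"])
  show "summable (\<lambda>n. (norm (ell2_nth v n))\<^sup>2 + (norm (ell2_nth w n))\<^sup>2)"
    by (intro summable_add ell2_summable)
next
  fix n
  have "norm (inner (ell2_nth v n) (ell2_nth w n)) \<le> norm (ell2_nth v n) * norm (ell2_nth w n)"
    using Cauchy_Schwarz_ineq2 by simp
  also have "\<dots> \<le> (norm (ell2_nth v n))\<^sup>2 + (norm (ell2_nth w n))\<^sup>2"
    using zero_le_power2[of "norm (ell2_nth v n) - norm (ell2_nth w n)"]
      zero_le_power2[of "norm (ell2_nth v n)"] zero_le_power2[of "norm (ell2_nth w n)"]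
    unfolding power2_diff by linarith
  finally show "norm (inner (ell2_nth v n) (ell2_nth w n))
      \<le> (norm (ell2_nth v n))\<^sup>2 + (norm (ell2_nth w n))\<^sup>2" .
qed

text \<open>The real inner product is the real part of the complex one; it induces the usual norm.\<close>

instantiation ell2 :: real_inner
begin

definition inner_ell2 :: "ell2 \<Rightarrow> ell2 \<Rightarrow> real" where
  "inner_ell2 v w = (\<Sum>n. inner (ell2_nth v n) (ell2_nth w n))"

definition norm_ell2 :: "ell2 \<Rightarrow> real" where
  "norm_ell2 v = sqrt (\<Sum>n. (norm (ell2_nth v n))\<^sup>2)"

definition sgn_ell2 :: "ell2 \<Rightarrow> ell2" where
  "sgn_ell2 v = v /\<^sub>R norm v"

definition dist_ell2 :: "ell2 \<Rightarrow> ell2 \<Rightarrow> real" where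
  "dist_ell2 v w = norm (v - w)"

definition uniformity_ell2 :: "(ell2 \<times> ell2) filter" where
  "uniformity_ell2 = (INF e\<in>{0 <..}. principal {(x, y). dist x y < e})"

definition open_ell2 :: "ell2 set \<Rightarrow> bool" where
  "open_ell2 U \<longleftrightarrow> (\<forall>x\<in>U. eventually (\<lambda>(x', y). x' = x \<longrightarrow> y \<in> U) uniformity)"

instance
proof
  fix x y z :: ell2 and r :: real
  show "inner x y = inner y x"
    by (simp add: inner_ell2_def inner_commute)
  show "inner (x + y) z = inner x z + inner y z"
    by (simp add: inner_ell2_def plus_ell2.rep_eq inner_add_left suminf_add ell2_inner_summable)
  show "inner (r *\<^sub>R x) y = r * inner x y"
    by (simp add: inner_ell2_def scaleR_ell2.rep_eq suminf_mult ell2_inner_summable)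
  show "0 \<le> inner x x"
    by (simp add: inner_ell2_def suminf_nonneg ell2_inner_summable)
  have "inner x x = 0 \<longleftrightarrow> (\<forall>n. ell2_nth x n = 0)"
    by (simp add: inner_ell2_def suminf_eq_zero_iff ell2_inner_summable)
  also have "\<dots> \<longleftrightarrow> x = 0"
    by transfer (simp add: fun_eq_iff)
  finally show "inner x x = 0 \<longleftrightarrow> x = 0" .
  show "norm x = sqrt (inner x x)"
    by (simp add: norm_ell2_def inner_ell2_def power2_norm_eq_inner)
qed (auto simp: sgn_ell2_def dist_ell2_def uniformity_ell2_def open_ell2_def)

end

global_interpretation ell2: vector_space scaleC_ell2
  defines ell2_span = ell2.span and ell2_subspace = ell2.subspace
  by standard (transfer; auto simp: fun_eq_iff algebra_simps)+

definition bounded_clinear_ell2 :: "(ell2 \<Rightarrow> ell2) \<Rightarrow> bool" where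
  "bounded_clinear_ell2 T \<longleftrightarrow>
     bounded_linear T \<and> (\<forall>c v. T (scaleC_ell2 c v) = scaleC_ell2 c (T v))"

definition op_shift :: "(ell2 \<Rightarrow> ell2) \<Rightarrow> complex \<Rightarrow> ell2 \<Rightarrow> ell2" where
  "op_shift T lam = (\<lambda>v. T v - scaleC_ell2 lam v)"

definition op_spectrum :: "(ell2 \<Rightarrow> ell2) \<Rightarrow> complex set" where
  "op_spectrum T = {lam. \<not> (\<exists>S. bounded_clinear_ell2 S \<and>
     S \<circ> op_shift T lam = id \<and> op_shift T lam \<circ> S = id)}"

definition fin_dim_ell2 :: "ell2 set \<Rightarrow> bool" where
  "fin_dim_ell2 V \<longleftrightarrow> (\<exists>B. finite B \<and> V = ell2_span B)"

definition fin_codim_ell2 :: "ell2 set \<Rightarrow> bool" where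
  "fin_codim_ell2 V \<longleftrightarrow> (\<exists>B. finite B \<and> ell2_span (V \<union> B) = UNIV)"

definition fredholm :: "(ell2 \<Rightarrow> ell2) \<Rightarrow> bool" where
  "fredholm T \<longleftrightarrow> bounded_clinear_ell2 T \<and> closed (range T) \<and>
     fin_dim_ell2 {v. T v = 0} \<and> fin_codim_ell2 (range T)"

definition ess_spectrum :: "(ell2 \<Rightarrow> ell2) \<Rightarrow> complex set" where
  "ess_spectrum T = {lam. \<not> fredholm (op_shift T lam)}"

definition exp_decaying :: "ell2 \<Rightarrow> bool" where
  "exp_decaying v \<longleftrightarrow> (\<exists>C r. 0 < r \<and> r < 1 \<and> (\<forall>n. norm (ell2_nth v n) \<le> C * r ^ n))"

definition edge_spectrum :: "(ell2 \<Rightarrow> ell2) \<Rightarrow> complex set" where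
  "edge_spectrum T = {lam. lam \<notin> ess_spectrum T \<and>
     (\<exists>v. v \<noteq> 0 \<and> exp_decaying v \<and> T v = scaleC_ell2 lam v)}"

definition tridiag_entry :: "nat \<Rightarrow> (nat \<Rightarrow> complex) \<Rightarrow> (nat \<Rightarrow> complex) \<Rightarrow> nat \<Rightarrow> nat \<Rightarrow> complex" where
  "tridiag_entry k a b m n =
     (if n = m then a (m mod k)
      else if n = Suc m then b (m mod k)
      else if m = Suc n then b (n mod k)
      else 0)"

definition toeplitz_op :: "nat \<Rightarrow> (nat \<Rightarrow> complex) \<Rightarrow> (nat \<Rightarrow> complex) \<Rightarrow> ell2 \<Rightarrow> ell2" where
  "toeplitz_op k a b v = Abs_ell2 (\<lambda>m. \<Sum>n. tridiag_entry k a b m n * ell2_nth v n)"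

lemma tridiag_entry_suminf:
  "(\<Sum>n. tridiag_entry k a b m n * v n) =
     a (m mod k) * v m + b (m mod k) * v (Suc m)
       + (if m = 0 then 0 else b ((m - 1) mod k) * v (m - 1))"
proof -
  have "(\<Sum>n. tridiag_entry k a b m n * v n) =
      (\<Sum>n\<in>{m, Suc m, m - 1}. tridiag_entry k a b m n * v n)"
    by (rule suminf_finite) (auto simp: tridiag_entry_def)
  then show ?thesis
    by (cases m) (simp_all add: tridiag_entry_def sum.insert_if insert_commute)
qed

text \<open>For \<open>k > 0\<close> the matrix maps square-summable sequences to square-summable sequences, so
  \<open>Abs_ell2\<close> is applied within its domain.\<close>

lemma ell2_nth_toeplitz_op:
  assumes "k > 0"
  shows "ell2_nth (toeplitz_op k a b v) m = (\<Sum>n. tridiag_entry k a b m n * ell2_nth v n)"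
proof -
  have bd: "norm (c (n mod k)) \<le> (\<Sum>i<k. norm (c i))" for c :: "nat \<Rightarrow> complex" and n
    using assms by (intro member_le_sum) auto
  define v1 where "v1 = (\<lambda>m. b (m mod k) * ell2_nth v m)"
  have s1: "summable (\<lambda>m. (norm (v1 m))\<^sup>2)"
    unfolding v1_def by (rule sq_summable_mult[OF ell2_summable bd])
  define v2 where "v2 = (\<lambda>m. if m = 0 then 0 else v1 (m - 1))"
  have s2: "summable (\<lambda>m. (norm (v2 m))\<^sup>2)"
    using s1 by (subst summable_Suc_iff[symmetric]) (simp add: v2_def)
  have "summable (\<lambda>m. (norm (ell2_nth v (Suc m)))\<^sup>2)"
    using ell2_summable[of v] by (subst summable_Suc_iff)
  from sq_summable_mult[OF this bd]
  have s3: "summable (\<lambda>m. (norm (b (m mod k) * ell2_nth v (Suc m)))\<^sup>2)" .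
  have "summable (\<lambda>m. (norm (a (m mod k) * ell2_nth v m + b (m mod k) * ell2_nth v (Suc m) + v2 m))\<^sup>2)"
    by (intro sq_summable_add s2 s3 sq_summable_mult[OF ell2_summable bd])
  then have "summable (\<lambda>m. (norm (\<Sum>n. tridiag_entry k a b m n * ell2_nth v n))\<^sup>2)"
    unfolding tridiag_entry_suminf v2_def v1_def by simp
  then show ?thesis
    unfolding toeplitz_op_def by (subst Abs_ell2_inverse) auto
qed

definition A0_mat :: "nat \<Rightarrow> (nat \<Rightarrow> complex) \<Rightarrow> (nat \<Rightarrow> complex) \<Rightarrow> complex mat" where
  "A0_mat k a b = mat k k (\<lambda>(i, j). tridiag_entry k a b i j)"

definition Aminus1_mat :: "nat \<Rightarrow> (nat \<Rightarrow> complex) \<Rightarrow> complex mat" where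
  "Aminus1_mat k b = mat k k (\<lambda>(i, j). if i = k - 1 \<and> j = 0 then b (k - 1) else 0)"

definition A1_mat :: "nat \<Rightarrow> (nat \<Rightarrow> complex) \<Rightarrow> complex mat" where
  "A1_mat k b = mat k k (\<lambda>(i, j). if i = 0 \<and> j = k - 1 then b (k - 1) else 0)"

definition symbol :: "nat \<Rightarrow> (nat \<Rightarrow> complex) \<Rightarrow> (nat \<Rightarrow> complex) \<Rightarrow> complex \<Rightarrow> complex mat" where
  "symbol k a b z = inverse z \<cdot>\<^sub>m Aminus1_mat k b + A0_mat k a b + z \<cdot>\<^sub>m A1_mat k b"

text \<open>For \<open>k = 1\<close> this is the \<open>0 \<times> 0\<close> matrix, whose spectrum is empty.\<close>

definition B0_mat :: "nat \<Rightarrow> (nat \<Rightarrow> complex) \<Rightarrow> (nat \<Rightarrow> complex) \<Rightarrow> complex mat" where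
  "B0_mat k a b = mat (k - 1) (k - 1) (\<lambda>(i, j). A0_mat k a b $$ (i, j))"

definition det_spectrum :: "nat \<Rightarrow> (nat \<Rightarrow> complex) \<Rightarrow> (nat \<Rightarrow> complex) \<Rightarrow> complex set" where
  "det_spectrum k a b =
     {lam. \<exists>z. cmod z = 1 \<and> det (symbol k a b z - lam \<cdot>\<^sub>m 1\<^sub>m k) = 0}"

text \<open>
  The determinant of \<open>f(z) - \<lambda>\<close> is a Laurent polynomial in \<open>z\<close> of degree and pole order at most one,
  so \<open>z det (f(z) - \<lambda>)\<close> agrees for \<open>z \<noteq> 0\<close> with exactly one polynomial \<open>q\<close>; its roots are
  counted with multiplicity.
\<close>

definition Gamma_set :: "nat \<Rightarrow> (nat \<Rightarrow> complex) \<Rightarrow> (nat \<Rightarrow> complex) \<Rightarrow> complex set" where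
  "Gamma_set k a b = {lam. \<exists>q z1 z2.
     (\<forall>z. z \<noteq> 0 \<longrightarrow> poly q z = z * det (symbol k a b z - lam \<cdot>\<^sub>m 1\<^sub>m k)) \<and>
     proots q = {#z1, z2#} \<and> cmod z1 = cmod z2}"

definition edge_momentum ::
  "nat \<Rightarrow> (nat \<Rightarrow> complex) \<Rightarrow> (nat \<Rightarrow> complex) \<Rightarrow> complex \<Rightarrow> complex \<Rightarrow> bool" where
  "edge_momentum k a b lam z \<longleftrightarrow> z \<noteq> 0 \<and>
     (\<exists>v \<in> carrier_vec k. v \<noteq> 0\<^sub>v k \<and>
        (symbol k a b z - lam \<cdot>\<^sub>m 1\<^sub>m k) *\<^sub>v v = 0\<^sub>v k \<and> v $ (k - 1) = 0)"

end

(* Shift sequences by one, so that U 0 is the value in front of the half-line. Solutions of the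
   periodic three-term recurrence with U (n + k) = w U n (Bloch solutions) correspond to kernel
   vectors of f(1/w) - lam. Since the monodromy matrix has determinant 1, the multipliers come in a
   pair w, 1/w, and lam lies outside the determinantal spectrum iff |w| < 1 for a suitable choice.
   Then the decaying solution phi and a growing solution psi give a bounded Green operator with
   kernel psi(min) phi(max). If phi 0 is nonzero, psi can be chosen with psi 0 = 0 and the Green
   operator inverts T - lam. If phi 0 = 0, then phi is an edge state and the Green operator is an
   inverse up to rank one, so T - lam is Fredholm. On the determinantal spectrum, truncated bounded
   Bloch solutions contradict the boundedness of an inverse. *)

theory Submission
  imports Defs
begin

section \<open>Operators on square-summable sequences\<close>

text \<open>The coefficients are complex, so \<open>T\<close> need not be normal and no spectral
  theorem applies: outside the determinantal spectrum everything has to come from an explicitly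
  constructed operator. What replaces self-adjointness is the symmetry of the matrix, in the form of
  a conserved Wronskian. Paired with the decaying solution \<open>\<phi>\<close> it tends to 0 along
  any bounded sequence; being constant wherever the recurrence holds, it must then vanish there.
  This one argument gives the injectivity of \<open>T\<close> when \<open>\<phi> 0\<close> is
  nonzero, keeps the first unit vector out of the range when \<open>\<phi> 0\<close> is zero, and
  shows that a decaying Bloch solution excludes multipliers of modulus 1.\<close>

lemma ell2_eqI: "(\<And>n. ell2_nth v n = ell2_nth w n) \<Longrightarrow> v = w"
  by (metis ell2_nth_inject ext)

lemma scaleR_ell2_eq_scaleC: "r *\<^sub>R v = scaleC_ell2 (complex_of_real r) v"
  by (rule ell2_eqI) (simp add: scaleR_ell2.rep_eq scaleC_ell2.rep_eq scaleR_conv_of_real)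

lemma sum_sq_le_norm_ell2: "(\<Sum>m<N. (norm (ell2_nth v m))\<^sup>2) \<le> (norm v)\<^sup>2"
  using sum_le_suminf[OF ell2_summable[of v], of "{..<N}"]
  by (simp add: norm_ell2_def suminf_nonneg ell2_summable)

lemma norm_ell2_nth_le: "norm (ell2_nth v m) \<le> norm v"
proof (rule power2_le_imp_le)
  show "(norm (ell2_nth v m))\<^sup>2 \<le> (norm v)\<^sup>2"
    using sum_sq_le_norm_ell2[of v "Suc m"] sum_nonneg[of "{..<m}" "\<lambda>m. (norm (ell2_nth v m))\<^sup>2"]
    unfolding sum.lessThan_Suc by (smt (verit) zero_le_power2)
qed simp

lemma ell2_nth_tendsto_0: "(\<lambda>n. ell2_nth v n) \<longlonglongrightarrow> 0"
proof -
  have "(\<lambda>n. sqrt ((norm (ell2_nth v n))\<^sup>2)) \<longlonglongrightarrow> sqrt 0"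
    by (intro tendsto_real_sqrt summable_LIMSEQ_zero ell2_summable)
  then show ?thesis
    by (simp add: tendsto_norm_zero_iff)
qed

lemma norm_ell2_le:
  assumes "\<And>N. (\<Sum>m<N. (norm (ell2_nth v m))\<^sup>2) \<le> K\<^sup>2" and "0 \<le> K"
  shows "norm v \<le> K"
  unfolding norm_ell2_def
  by (rule real_le_lsqrt)
    (use assms in \<open>auto intro!: suminf_le_const ell2_summable\<close>)

lemma ell2_nth_Abs_bounded:
  assumes "\<And>N. (\<Sum>m<N. (norm (v m))\<^sup>2) \<le> K"
  shows "ell2_nth (Abs_ell2 v) = v"
  by (rule Abs_ell2_inverse)
    (use assms in \<open>auto intro!: summableI_nonneg_bounded\<close>)

lemma ell2_nth_Abs_finite:
  assumes "finite {n. v n \<noteq> 0}"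
  shows "ell2_nth (Abs_ell2 v) = v"
  by (rule Abs_ell2_inverse) (use assms in \<open>auto intro!: summable_finite[of "{n. v n \<noteq> 0}"]\<close>)

text \<open>Bounding the finite partial sums of the raw formula \<open>F\<close> gives two things at
  once: \<open>F v\<close> is square-summable, so \<open>Abs_ell2\<close> is applied within its
  domain, and \<open>K\<close> bounds the operator norm. Both \<open>T\<close> and the Green
  operator are obtained in this way.\<close>

lemma bounded_clinear_ell2I:
  assumes add: "\<And>v w m. F (v + w) m = F v m + F w m"
    and scale: "\<And>c v m. F (scaleC_ell2 c v) m = c * F v m"
    and bd: "\<And>v N. (\<Sum>m<N. (norm (F v m))\<^sup>2) \<le> (K * norm v)\<^sup>2" and K: "0 \<le> K"
  shows "bounded_clinear_ell2 (\<lambda>v. Abs_ell2 (F v))"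
proof -
  have nth: "ell2_nth (Abs_ell2 (F v)) = F v" for v
    by (rule ell2_nth_Abs_bounded[OF bd])
  have sc: "Abs_ell2 (F (scaleC_ell2 c v)) = scaleC_ell2 c (Abs_ell2 (F v))" for c v
    by (rule ell2_eqI) (simp add: nth scaleC_ell2.rep_eq scale)
  have "bounded_linear (\<lambda>v. Abs_ell2 (F v))"
  proof (rule bounded_linear_intro[where K = K])
    show "Abs_ell2 (F (v + w)) = Abs_ell2 (F v) + Abs_ell2 (F w)" for v w
      by (rule ell2_eqI) (simp add: nth plus_ell2.rep_eq add)
    show "Abs_ell2 (F (r *\<^sub>R v)) = r *\<^sub>R Abs_ell2 (F v)" for r v
      by (simp add: scaleR_ell2_eq_scaleC sc)
    show "norm (Abs_ell2 (F v)) \<le> norm v * K" for v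
      by (rule norm_ell2_le) (use bd[of v] K in \<open>auto simp: nth mult.commute\<close>)
  qed
  with sc show ?thesis by (simp add: bounded_clinear_ell2_def)
qed

lemma bounded_clinear_ell2_diff:
  assumes "bounded_clinear_ell2 T"
  shows "T (v - w) = T v - T w"
  using assms unfolding bounded_clinear_ell2_def by (simp add: linear_diff bounded_linear.linear)

text \<open>Convexity of the square at \<open>r * x + (1 - r) * (y / (1 - r))\<close>. The factor
  \<open>r < 1\<close> in front of the square of \<open>x\<close> lets a sum along a first-order
  recursion absorb this term.\<close>

lemma convex_sq_le:
  fixes r x y :: real
  assumes "0 \<le> r" "r < 1"
  shows "(r * x + y)\<^sup>2 \<le> r * x\<^sup>2 + y\<^sup>2 / (1 - r)"
proof -
  have "r * x\<^sup>2 + y\<^sup>2 / (1 - r) - (r * x + y)\<^sup>2 = r / (1 - r) * ((1 - r) * x - y)\<^sup>2"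
    using assms by (simp add: field_simps power2_eq_square)
  moreover have "\<dots> \<ge> 0" using assms by simp
  ultimately show ?thesis by linarith
qed

text \<open>The next two lemmas replace the Schur test for kernels bounded by \<open>r ^ \<bar>m - n\<bar>\<close>: the lower and
  upper triangular parts of such a kernel solve first-order recursions.\<close>

lemma sum_sq_forward_recursion:
  fixes p y :: "nat \<Rightarrow> real"
  assumes r: "0 \<le> r" "r < 1" and p0: "p 0 = y 0" and p: "\<And>n. p (Suc n) = r * p n + y (Suc n)"
  shows "(\<Sum>m<N. (p m)\<^sup>2) \<le> (\<Sum>m<N. (y m)\<^sup>2) / (1 - r)\<^sup>2"
proof (cases N)
  case (Suc M)
  \<comment> \<open>The extra term with factor \<open>r\<close> completes the last summand to the
    full square of \<open>p M\<close>; in the induction step it is exactly what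
    \<open>convex_sq_le\<close> consumes.\<close>
  have "(1 - r) * (\<Sum>m<Suc M. (p m)\<^sup>2) + r * (p M)\<^sup>2 \<le> (\<Sum>m<Suc M. (y m)\<^sup>2) / (1 - r)"
  proof (induction M)
    case 0
    have "(y 0)\<^sup>2 * (1 - r) \<le> (y 0)\<^sup>2"
      using r by (simp add: mult_left_le)
    then show ?case using r by (simp add: p0 field_simps)
  next
    case (Suc M)
    then show ?case
      using convex_sq_le[OF r, of "p M" "y (Suc M)"] r
      by (simp add: p add_divide_distrib algebra_simps)
  qed
  moreover have "0 \<le> r * (p M)\<^sup>2" using r by simp
  ultimately have "(1 - r) * (\<Sum>m<N. (p m)\<^sup>2) \<le> (\<Sum>m<N. (y m)\<^sup>2) / (1 - r)"
    unfolding Suc by linarith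
  then have "(\<Sum>m<N. (p m)\<^sup>2) \<le> (\<Sum>m<N. (y m)\<^sup>2) / (1 - r) / (1 - r)"
    using r by (simp add: pos_le_divide_eq mult.commute)
  then show ?thesis by (simp add: power2_eq_square)
qed simp

lemma sum_sq_backward_recursion:
  fixes q y :: "nat \<Rightarrow> real"
  assumes r: "0 \<le> r" "r < 1" and q: "\<And>n. q n = r * q (Suc n) + y n"
    and B: "\<And>n. \<bar>q n\<bar> \<le> B" and Y: "\<And>N. (\<Sum>m<N. (y m)\<^sup>2) \<le> Y"
  shows "(\<Sum>m<N. (q m)\<^sup>2) \<le> Y / (1 - r)\<^sup>2"
proof -
  \<comment> \<open>A backward recursion has no initial value, so a boundary term at the far end
    \<open>M\<close> remains.\<close>
  have main: "(1 - r) * (\<Sum>m<M. (q m)\<^sup>2) \<le> r * (q M)\<^sup>2 + Y / (1 - r)" for M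
  proof -
    have "(1 - r) * (\<Sum>m<M. (q m)\<^sup>2) \<le> r * (q M)\<^sup>2 - r * (q 0)\<^sup>2 + (\<Sum>m<M. (y m)\<^sup>2) / (1 - r)"
    proof (induction M)
      case (Suc M)
      then show ?case
        using convex_sq_le[OF r, of "q (Suc M)" "y M"] q[of M]
        by (simp add: add_divide_distrib algebra_simps)
    qed simp
    also have "\<dots> \<le> r * (q M)\<^sup>2 + Y / (1 - r)"
    proof -
      have "(\<Sum>m<M. (y m)\<^sup>2) / (1 - r) \<le> Y / (1 - r)"
        using r Y by (intro divide_right_mono) auto
      moreover have "0 \<le> r * (q 0)\<^sup>2" using r by simp
      ultimately show ?thesis by linarith
    qed
    finally show ?thesis .
  qed
  \<comment> \<open>The crude bound \<open>B\<close> only serves to establish summability. Then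
    \<open>q M\<close> tends to 0, the boundary term disappears in the limit, and \<open>B\<close>
    does not enter the final estimate.\<close>
  have "(\<Sum>m<M. (q m)\<^sup>2) \<le> (r * B\<^sup>2 + Y / (1 - r)) / (1 - r)" for M
  proof -
    have "(q M)\<^sup>2 \<le> B\<^sup>2" using B[of M] by (metis abs_ge_zero power2_abs power_mono)
    then have "r * (q M)\<^sup>2 \<le> r * B\<^sup>2" using r by (intro mult_left_mono) auto
    then have "(1 - r) * (\<Sum>m<M. (q m)\<^sup>2) \<le> r * B\<^sup>2 + Y / (1 - r)"
      using main[of M] by linarith
    then show ?thesis using r by (simp add: pos_le_divide_eq mult.commute)
  qed
  then have "summable (\<lambda>m. (q m)\<^sup>2)"
    by (intro summableI_nonneg_bounded) auto
  then have "(\<lambda>M. r * (q M)\<^sup>2 + Y / (1 - r)) \<longlonglongrightarrow> r * 0 + Y / (1 - r)"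
    by (intro tendsto_intros summable_LIMSEQ_zero)
  moreover have "(1 - r) * (\<Sum>m<N. (q m)\<^sup>2) \<le> r * (q M)\<^sup>2 + Y / (1 - r)" if "M \<ge> N" for M
  proof -
    have "(\<Sum>m<N. (q m)\<^sup>2) \<le> (\<Sum>m<M. (q m)\<^sup>2)"
      using that by (intro sum_mono2) auto
    then have "(1 - r) * (\<Sum>m<N. (q m)\<^sup>2) \<le> (1 - r) * (\<Sum>m<M. (q m)\<^sup>2)"
      using r by (intro mult_left_mono) auto
    then show ?thesis using main[of M] by linarith
  qed
  ultimately have "(1 - r) * (\<Sum>m<N. (q m)\<^sup>2) \<le> Y / (1 - r)"
    by (intro LIMSEQ_le_const[where a = "(1 - r) * (\<Sum>m<N. (q m)\<^sup>2)"]) auto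
  then have "(\<Sum>m<N. (q m)\<^sup>2) \<le> Y / (1 - r) / (1 - r)"
    using r by (simp add: pos_le_divide_eq mult.commute)
  then show ?thesis by (simp add: power2_eq_square)
qed

section \<open>The periodic difference equation\<close>

text \<open>A sequence \<open>U\<close> has its indices shifted by one against \<^term>\<open>toeplitz_op\<close>: \<open>U 0\<close> is the value
  in front of the half-line, where the operator imposes the boundary condition \<open>U 0 = 0\<close>.\<close>

locale periodic_jacobi =
  fixes k :: nat and a b :: "nat \<Rightarrow> complex" and lam :: complex
  assumes k_pos: "k \<ge> 1" and b_nz: "\<forall>i<k. b i \<noteq> 0"
begin

definition \<alpha> :: "nat \<Rightarrow> complex" where "\<alpha> n = a (n mod k) - lam"

text \<open>This is the coupling in front of site \<open>n\<close>. The index \<open>n - 1\<close>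
  is taken as \<open>n + k - 1\<close> so that truncated subtraction does no harm at
  \<open>n = 0\<close>, where periodicity asks for \<open>b (k - 1)\<close>.\<close>

definition \<beta> :: "nat \<Rightarrow> complex" where "\<beta> n = b ((n + k - 1) mod k)"

text \<open>Row \<open>n\<close> of the Toeplitz matrix minus \<open>lam\<close>, acting at site
  \<open>Suc n\<close>; at \<open>n = 0\<close> the last term adds a coupling to the boundary value
  \<open>U 0\<close>.\<close>

definition J :: "(nat \<Rightarrow> complex) \<Rightarrow> nat \<Rightarrow> complex" where
  "J U n = \<beta> (Suc n) * U (Suc (Suc n)) + \<alpha> n * U (Suc n) + \<beta> n * U n"

text \<open>The Casoratian, with the weight that makes it constant for a symmetric three-term
  recurrence.\<close>

definition wronskian :: "(nat \<Rightarrow> complex) \<Rightarrow> (nat \<Rightarrow> complex) \<Rightarrow> nat \<Rightarrow> complex" where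
  "wronskian U V n = \<beta> n * (U n * V (Suc n) - U (Suc n) * V n)"

definition bloch :: "complex \<Rightarrow> (nat \<Rightarrow> complex) \<Rightarrow> bool" where
  "bloch w U \<longleftrightarrow> (\<forall>n. J U n = 0) \<and> (\<forall>n. U (n + k) = w * U n) \<and> (\<exists>n. U n \<noteq> 0)"

lemma \<beta>_Suc: "\<beta> (Suc n) = b (n mod k)"
  by (simp add: \<beta>_def)

lemma \<beta>_nz: "\<beta> n \<noteq> 0"
  using b_nz k_pos by (simp add: \<beta>_def)

lemma \<beta>_periodic: "\<beta> (n + k) = \<beta> n"
proof -
  have "n + k + k - 1 = (n + k - 1) + k" using k_pos by simp
  then show ?thesis by (simp add: \<beta>_def)
qed

lemma \<alpha>_periodic: "\<alpha> (n + k) = \<alpha> n"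
  by (simp add: \<alpha>_def)

lemma J_shift: "J (\<lambda>n. U (n + k)) n = J U (n + k)"
  using \<beta>_periodic[of n] \<beta>_periodic[of "Suc n"] by (simp add: J_def \<alpha>_periodic)

lemma bounded_coeff: "\<exists>D\<ge>0. \<forall>n. norm (\<alpha> n) \<le> D \<and> norm (\<beta> n) \<le> D"
proof -
  have bd: "norm (c (n mod k)) \<le> (\<Sum>i<k. norm (c i))" for c :: "nat \<Rightarrow> complex" and n
    using k_pos by (intro member_le_sum) auto
  show ?thesis
  proof (intro exI conjI allI)
    show "0 \<le> (\<Sum>i<k. norm (a i - lam)) + (\<Sum>i<k. norm (b i))"
      by (intro add_nonneg_nonneg sum_nonneg) auto
    show "norm (\<alpha> n) \<le> (\<Sum>i<k. norm (a i - lam)) + (\<Sum>i<k. norm (b i))" for n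
      using bd[of "\<lambda>i. a i - lam" n] sum_nonneg[of "{..<k}" "\<lambda>i. norm (b i)"] by (simp add: \<alpha>_def)
    show "norm (\<beta> n) \<le> (\<Sum>i<k. norm (a i - lam)) + (\<Sum>i<k. norm (b i))" for n
      using bd[of b "n + k - 1"] sum_nonneg[of "{..<k}" "\<lambda>i. norm (a i - lam)"] by (simp add: \<beta>_def)
  qed
qed

text \<open>A discrete Green identity. Leaving \<open>V\<close> arbitrary makes it usable both for
  pairs of solutions and for a vector whose image under \<open>T\<close> is a multiple of the first
  unit vector.\<close>

lemma wronskian_Suc:
  assumes "J U n = 0"
  shows "wronskian U V (Suc n) = wronskian U V n + U (Suc n) * J V n"
proof -
  have "wronskian U V (Suc n) = wronskian U V n + U (Suc n) * J V n - J U n * V (Suc n)"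
    by (simp add: wronskian_def J_def algebra_simps)
  then show ?thesis using assms by simp
qed

lemma wronskian_const:
  assumes "\<And>n. J U n = 0" "\<And>n. J V n = 0"
  shows "wronskian U V n = wronskian U V 0"
  by (induction n) (simp_all add: wronskian_Suc assms)

text \<open>Since \<open>\<beta> (Suc m)\<close> is nonzero, row \<open>m\<close> determines the
  value at \<open>m + 2\<close>. The version with finitely many rows is meant for eigenvectors of
  \<open>B0_mat\<close>, which satisfy the recurrence only inside one period.\<close>

lemma sol_unique:
  assumes "U 0 = V 0" "U 1 = V 1" "\<And>n. n < N \<Longrightarrow> J U n = 0" "\<And>n. n < N \<Longrightarrow> J V n = 0"
    and "n \<le> Suc N"
  shows "U n = V n"
  using assms(5)
proof (induction n rule: less_induct)
  case (less n)
  consider "n = 0" | "n = 1" | m where "n = Suc (Suc m)"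
    by (metis One_nat_def not0_implies_Suc)
  then show ?case
  proof cases
    case 3
    then have "J U m = 0" "J V m = 0" "U m = V m" "U (Suc m) = V (Suc m)"
      using less assms(3,4) by auto
    then have "\<beta> (Suc m) * U n = \<beta> (Suc m) * V n"
      unfolding J_def 3 by (metis add_right_cancel)
    then show ?thesis using \<beta>_nz by simp
  qed (use assms(1,2) in auto)
qed

lemma sol_eqI:
  assumes "\<And>n. J U n = 0" "\<And>n. J V n = 0" "U 0 = V 0" "U 1 = V 1"
  shows "U n = V n"
  by (rule sol_unique[of U V n]) (use assms in simp_all)

section \<open>Fundamental solutions, the monodromy matrix and its eigenvalues\<close>

fun sol :: "complex \<Rightarrow> complex \<Rightarrow> nat \<Rightarrow> complex" where
  "sol x y 0 = x"
| "sol x y (Suc 0) = y"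
| "sol x y (Suc (Suc n)) = - (\<alpha> n * sol x y (Suc n) + \<beta> n * sol x y n) / \<beta> (Suc n)"

lemma J_sol: "J (sol x y) n = 0"
  using \<beta>_nz by (simp add: J_def)

lemma J_lincomb: "J (\<lambda>n. c * U n + d * V n) n = c * J U n + d * J V n"
  by (simp add: J_def algebra_simps)

lemma J_cmult: "J (\<lambda>n. c * U n) n = c * J U n"
  by (simp add: J_def algebra_simps)

lemma sol_lincomb: "sol x y n = x * sol 1 0 n + y * sol 0 1 n"
  by (rule sol_eqI) (auto simp: J_lincomb J_sol simp del: sol.simps(3))

text \<open>The Wronskian of the two fundamental solutions agrees at 0 and at \<open>k\<close>, and
  the weights cancel because \<open>\<beta> k = \<beta> 0\<close>.\<close>

lemma monodromy_det: "sol 1 0 k * sol 0 1 (Suc k) - sol 1 0 (Suc k) * sol 0 1 k = 1"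
proof -
  have "wronskian (sol 1 0) (sol 0 1) k = wronskian (sol 1 0) (sol 0 1) 0"
    by (rule wronskian_const) (rule J_sol)+
  then show ?thesis
    using \<beta>_nz[of 0] \<beta>_periodic[of 0] by (simp add: wronskian_def)
qed

text \<open>Shifting by \<open>k\<close> and scaling by \<open>w\<close> both map solutions to
  solutions, so it suffices to compare two initial values.\<close>

lemma bloch_solI:
  assumes "sol x y k = w * x" "sol x y (Suc k) = w * y" "x \<noteq> 0 \<or> y \<noteq> 0"
  shows "bloch w (sol x y)"
proof -
  have "sol x y (n + k) = w * sol x y n" for n
    by (rule sol_eqI[where U = "\<lambda>n. sol x y (n + k)"])
      (use assms in \<open>simp_all add: J_shift J_cmult J_sol\<close>)
  moreover have "\<exists>n. sol x y n \<noteq> 0"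
    using assms(3) by (metis sol.simps(1,2))
  ultimately show ?thesis
    by (simp add: bloch_def J_sol)
qed

lemma bloch_initial_nz:
  assumes "bloch w U"
  shows "U 0 \<noteq> 0 \<or> U 1 \<noteq> 0"
proof (rule ccontr)
  assume "\<not> ?thesis"
  then have "U n = 0" for n
    using assms sol_eqI[of U "\<lambda>_. 0" n] by (simp add: bloch_def) (simp add: J_def)
  then show False using assms by (auto simp: bloch_def)
qed

text \<open>The hypothesis is the characteristic equation of the monodromy matrix, with its trace as
  the coefficient and determinant 1. An eigenvector supplies the initial values of a Bloch
  solution.\<close>

lemma bloch_exists:
  assumes w: "w\<^sup>2 - (sol 1 0 k + sol 0 1 (Suc k)) * w + 1 = 0"
  shows "\<exists>U. bloch w U"
proof -
  define p q r s where "p = sol 1 0 k" "q = sol 0 1 k" "r = sol 1 0 (Suc k)" "s = sol 0 1 (Suc k)"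
  note defs = this
  have char: "(p - w) * (s - w) = r * q"
    using w monodromy_det unfolding defs[symmetric] by (simp add: algebra_simps power2_eq_square)
  have B: "\<exists>U. bloch w U" if "x * p + y * q = w * x" "x * r + y * s = w * y" "x \<noteq> 0 \<or> y \<noteq> 0" for x y
    using that sol_lincomb[of x y k] sol_lincomb[of x y "Suc k"] unfolding defs
    by (intro exI[of _ "sol x y"] bloch_solI) simp_all
  show ?thesis
  proof (cases "q = 0 \<and> r = 0")
    case False
    then consider "q \<noteq> 0" | "r \<noteq> 0" by blast
    then show ?thesis
    proof cases
      case 1
      \<comment> \<open>The pair \<open>q\<close>, \<open>w - p\<close> satisfies the first row of
        the eigenvector equation identically; the second row is \<open>char\<close>. The other case
        exchanges the rows.\<close>
      show ?thesis
        by (rule B[of q "w - p"]) (use 1 char in \<open>auto simp: algebra_simps\<close>)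
    next
      case 2
      show ?thesis
        by (rule B[of "w - s" r]) (use 2 char in \<open>auto simp: algebra_simps\<close>)
    qed
  next
    case True
    then have "p = w \<or> s = w" using char by auto
    then show ?thesis using B[of 1 0] B[of 0 1] True by auto
  qed
qed

text \<open>Determinant 1 makes the characteristic polynomial palindromic: with \<open>w\<close> its
  inverse is a root as well, and the constant term 1 excludes \<open>w = 0\<close>.\<close>

lemma bloch_pair_exists: "\<exists>w U V. w \<noteq> 0 \<and> bloch w U \<and> bloch (inverse w) V"
proof -
  define t where "t = sol 1 0 k + sol 0 1 (Suc k)"
  define w where "w = (t + csqrt (t\<^sup>2 - 4)) / 2"
  have "2 * w - t = csqrt (t\<^sup>2 - 4)" by (simp add: w_def field_simps)
  then have "(2 * w - t)\<^sup>2 = t\<^sup>2 - 4" by (simp only: power2_csqrt)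
  then have "4 * (w\<^sup>2 - t * w + 1) = 0" by (simp add: power2_eq_square algebra_simps)
  then have w: "w\<^sup>2 - t * w + 1 = 0" by (simp only: mult_eq_0_iff) simp
  then have "w \<noteq> 0" by auto
  then have "(inverse w)\<^sup>2 - t * inverse w + 1 = (w\<^sup>2 - t * w + 1) / w\<^sup>2"
    by (simp add: field_simps power2_eq_square)
  then have "(inverse w)\<^sup>2 - t * inverse w + 1 = 0" using w by simp
  with w \<open>w \<noteq> 0\<close> show ?thesis using bloch_exists unfolding t_def by blast
qed

section \<open>Growth and decay of Bloch solutions\<close>

lemma bloch_power:
  assumes "bloch w U"
  shows "U (j * k + n) = w ^ j * U n"
proof (induction j)
  case (Suc j)
  have "U (Suc j * k + n) = U (j * k + n + k)" by (simp add: ac_simps)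
  also have "\<dots> = w * U (j * k + n)" using assms unfolding bloch_def by blast
  finally show ?case using Suc by simp
qed simp

text \<open>A factor \<open>norm w\<close> per period is a factor \<open>\<rho>\<close> per site, up
  to the fluctuation within one period, which \<open>C\<close> collects; the summand 1 in
  \<open>C\<close> makes it positive.\<close>

lemma bloch_bound:
  assumes U: "bloch w U" and \<rho>: "\<rho> > 0" "\<rho> ^ k = norm w"
  shows "\<exists>C>0. \<forall>n. norm (U n) \<le> C * \<rho> ^ n"
proof -
  define C where "C = (\<Sum>i<k. norm (U i) / \<rho> ^ i) + 1"
  have "norm (U n) \<le> C * \<rho> ^ n" for n
  proof -
    have "norm (U (n mod k)) / \<rho> ^ (n mod k) \<le> (\<Sum>i<k. norm (U i) / \<rho> ^ i)"
      using k_pos \<rho> by (intro member_le_sum) auto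
    then have "norm (U (n mod k)) / \<rho> ^ (n mod k) \<le> C" by (simp add: C_def)
    then have le: "norm (U (n mod k)) \<le> C * \<rho> ^ (n mod k)"
      using \<rho> by (simp add: pos_divide_le_eq)
    have pw: "\<rho> ^ n = norm w ^ (n div k) * \<rho> ^ (n mod k)"
      by (metis \<rho>(2) div_mult_mod_eq mult.commute power_add power_mult)
    have "norm (U n) = norm w ^ (n div k) * norm (U (n mod k))"
      using bloch_power[OF U, of "n div k" "n mod k"] by (simp add: norm_mult norm_power)
    also have "\<dots> \<le> norm w ^ (n div k) * (C * \<rho> ^ (n mod k))"
      by (intro mult_left_mono le) simp
    also have "\<dots> = C * \<rho> ^ n" by (simp add: pw)
    finally show ?thesis .
  qed
  moreover have "C > 0"
    using \<rho> by (auto simp: C_def intro!: add_nonneg_pos sum_nonneg)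
  ultimately show ?thesis by blast
qed

lemma bloch_not_tendsto_0:
  assumes U: "bloch w U" and w: "norm w = 1" shows "\<not> U \<longlonglongrightarrow> 0"
proof
  assume lim: "U \<longlonglongrightarrow> 0"
  obtain n where n: "U n \<noteq> 0" using U by (auto simp: bloch_def)
  have "filterlim (\<lambda>j. j * k + n) sequentially sequentially"
    using k_pos by (intro filterlim_subseq strict_monoI) auto
  then have "(\<lambda>j. norm (U (j * k + n))) \<longlonglongrightarrow> 0"
    using lim by (intro tendsto_norm_zero) (rule filterlim_compose)
  then have "(\<lambda>j::nat. norm (U n)) \<longlonglongrightarrow> 0"
    by (simp add: bloch_power[OF U] norm_mult norm_power w)
  then show False using n LIMSEQ_unique[OF _ tendsto_const] by fastforce
qed

lemma wronskian_tendsto_0: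
  assumes U: "U \<longlonglongrightarrow> 0" and V: "Bseq V"
  shows "wronskian U V \<longlonglongrightarrow> 0"
proof -
  obtain D where D: "D \<ge> 0" "\<And>n. norm (\<beta> n) \<le> D" using bounded_coeff by blast
  obtain E where E: "E > 0" "\<And>n. norm (V n) \<le> E" using V by (auto elim: BseqE)
  show ?thesis
  proof (rule tendsto_0_le[where K = 1])
    have "(\<lambda>n. D * (norm (U n) * E + norm (U (Suc n)) * E)) \<longlonglongrightarrow> D * (0 * E + 0 * E)"
      by (intro tendsto_intros tendsto_norm_zero U LIMSEQ_Suc)
    then show "(\<lambda>n. D * (norm (U n) * E + norm (U (Suc n)) * E)) \<longlonglongrightarrow> 0" by simp
    show "\<forall>\<^sub>F n in sequentially.
        norm (wronskian U V n) \<le> norm (D * (norm (U n) * E + norm (U (Suc n)) * E)) * 1"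
    proof (intro always_eventually allI)
      fix n
      have "norm (U n * V (Suc n) - U (Suc n) * V n)
          \<le> norm (U n) * norm (V (Suc n)) + norm (U (Suc n)) * norm (V n)"
        by (metis norm_mult norm_triangle_ineq4)
      also have "\<dots> \<le> norm (U n) * E + norm (U (Suc n)) * E"
        by (intro add_mono mult_left_mono E) auto
      finally have "norm (wronskian U V n) \<le> D * (norm (U n) * E + norm (U (Suc n)) * E)"
        unfolding wronskian_def norm_mult by (intro mult_mono D) auto
      then show "norm (wronskian U V n) \<le> norm (D * (norm (U n) * E + norm (U (Suc n)) * E)) * 1"
        by (smt (verit) real_norm_def mult.right_neutral)
    qed
  qed
qed

lemma root_exists:
  assumes "w \<noteq> 0" "norm w < 1"
  shows "\<exists>\<rho>>0. \<rho> < 1 \<and> \<rho> ^ k = norm w"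
  using assms k_pos by (intro exI[of _ "root k (norm w)"]) simp

lemma bloch_tendsto_0:
  assumes U: "bloch w U" and w: "w \<noteq> 0" "norm w < 1"
  shows "U \<longlonglongrightarrow> 0"
proof -
  obtain \<rho> where \<rho>: "0 < \<rho>" "\<rho> < 1" "\<rho> ^ k = norm w" using root_exists[OF w] by blast
  then obtain C where C: "\<forall>n. norm (U n) \<le> C * \<rho> ^ n" using bloch_bound[OF U] by blast
  show ?thesis
  proof (rule Limits.tendsto_0_le[where K = 1])
    show "(\<lambda>n. C * \<rho> ^ n) \<longlonglongrightarrow> 0"
      using tendsto_mult_right_zero[OF LIMSEQ_realpow_zero[of \<rho>], of C] \<rho> by simp
    have "norm (U n) \<le> norm (C * \<rho> ^ n)" for n
      using C abs_ge_self order_trans by (metis real_norm_def)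
    then show "\<forall>\<^sub>F n in sequentially. norm (U n) \<le> norm (C * \<rho> ^ n) * 1" by simp
  qed
qed

section \<open>Bloch solutions and the symbol\<close>

text \<open>Continues a vector on one cell with multiplier \<open>inverse z\<close> per cell. Index
  0 belongs to the preceding cell, hence the factor \<open>z\<close> and the last component.\<close>

definition bloch_ext :: "complex \<Rightarrow> complex vec \<Rightarrow> nat \<Rightarrow> complex" where
  "bloch_ext z v n =
     (if n = 0 then z * v $ (k - 1) else inverse z ^ ((n - 1) div k) * v $ ((n - 1) mod k))"

text \<open>Cutting \<open>v\<close> off at \<open>N\<close> reduces a row of a finite section to
  the row sum of the infinite matrix. It serves \<open>A0_mat\<close> with \<open>N = k\<close> and
  \<open>B0_mat\<close> with \<open>N = k - 1\<close>.\<close>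

lemma tridiag_sum:
  assumes "m < N"
  shows "(\<Sum>j<N. tridiag_entry k a b m j * v j) =
    a (m mod k) * v m + (if Suc m < N then b (m mod k) * v (Suc m) else 0)
      + (if m = 0 then 0 else b ((m - 1) mod k) * v (m - 1))"
proof -
  define u where "u = (\<lambda>j. if j < N then v j else 0)"
  have "(\<Sum>j<N. tridiag_entry k a b m j * v j) = (\<Sum>j<N. tridiag_entry k a b m j * u j)"
    by (rule sum.cong) (auto simp: u_def)
  also have "\<dots> = (\<Sum>j. tridiag_entry k a b m j * u j)"
    by (rule suminf_finite[symmetric]) (auto simp: u_def)
  finally show ?thesis
    unfolding tridiag_entry_suminf using assms by (simp add: u_def)
qed

text \<open>The two corner entries of the symbol are the couplings to the neighbouring cells, whose
  values \<open>bloch_ext\<close> reproduces.\<close>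

lemma symbol_row:
  assumes v: "v \<in> carrier_vec k" and i: "i < k"
  shows "((symbol k a b z - lam \<cdot>\<^sub>m 1\<^sub>m k) *\<^sub>v v) $ i = J (bloch_ext z v) i"
proof -
  have "((symbol k a b z - lam \<cdot>\<^sub>m 1\<^sub>m k) *\<^sub>v v) $ i
      = (\<Sum>j<k. (inverse z * (if i = k - 1 \<and> j = 0 then b (k - 1) else 0) + tridiag_entry k a b i j
          + z * (if i = 0 \<and> j = k - 1 then b (k - 1) else 0) - lam * (if i = j then 1 else 0)) * v $ j)"
    using v i by (auto simp: symbol_def Aminus1_mat_def A0_mat_def A1_mat_def scalar_prod_def
        lessThan_atLeast0 intro!: sum.cong)
  \<comment> \<open>For \<open>k \<le> 2\<close> the corners fall on entries of the tridiagonal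
    block. Separate sums treat all \<open>k\<close> alike.\<close>
  also have "\<dots> = (\<Sum>j<k. if j = 0 then inverse z * (if i = k - 1 then b (k - 1) else 0) * v $ j else 0)
      + (\<Sum>j<k. tridiag_entry k a b i j * v $ j)
      + (\<Sum>j<k. if j = k - 1 then z * (if i = 0 then b (k - 1) else 0) * v $ j else 0)
      - (\<Sum>j<k. if j = i then lam * v $ j else 0)"
    unfolding sum.distrib[symmetric] sum_subtractf[symmetric]
    by (rule sum.cong) (auto simp: algebra_simps)
  also have "\<dots> = inverse z * (if i = k - 1 then b (k - 1) else 0) * v $ 0
      + (a i * v $ i + (if Suc i < k then b i * v $ Suc i else 0)
          + (if i = 0 then 0 else b (i - 1) * v $ (i - 1)))
      + z * (if i = 0 then b (k - 1) else 0) * v $ (k - 1) - lam * v $ i"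
    using i by (simp add: tridiag_sum)
  also have "\<dots> = J (bloch_ext z v) i"
  proof -
    have b0: "\<beta> i = (if i = 0 then b (k - 1) else b (i - 1))"
      using i by (cases i) (simp_all add: \<beta>_def)
    have b1: "\<beta> (Suc i) = b i" using i by (simp add: \<beta>_Suc)
    have "bloch_ext z v (Suc (Suc i)) = (if Suc i < k then v $ Suc i else inverse z * v $ 0)"
      using i by (cases "Suc i = k") (auto simp: bloch_ext_def)
    moreover have "bloch_ext z v (Suc i) = v $ i"
      using i by (simp add: bloch_ext_def)
    moreover have "bloch_ext z v i = (if i = 0 then z * v $ (k - 1) else v $ (i - 1))"
      using i by (auto simp: bloch_ext_def)
    ultimately show ?thesis
      using i by (auto simp: J_def b0 b1 \<alpha>_def algebra_simps)
  qed
  finally show ?thesis .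
qed

lemma bloch_bloch_ext:
  assumes v: "v \<in> carrier_vec k" "v \<noteq> 0\<^sub>v k" and z: "z \<noteq> 0"
    and ker: "(symbol k a b z - lam \<cdot>\<^sub>m 1\<^sub>m k) *\<^sub>v v = 0\<^sub>v k"
  shows "bloch (inverse z) (bloch_ext z v)"
proof -
  let ?U = "bloch_ext z v"
  have per: "?U (n + k) = inverse z * ?U n" for n
  proof (cases n)
    case 0
    then show ?thesis using k_pos z by (simp add: bloch_ext_def)
  next
    case (Suc m)
    have "(m + k) div k = Suc (m div k)" using k_pos by simp
    then show ?thesis by (simp add: bloch_ext_def Suc)
  qed
  have J_per: "J ?U (n + k) = inverse z * J ?U n" for n
    unfolding J_shift[symmetric] per by (rule J_cmult)
  have "J ?U n = 0" for n
  proof (induction n rule: less_induct)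
    case (less n)
    show ?case
    proof (cases "n < k")
      case True
      then show ?thesis using symbol_row[OF v(1) True, of z] ker by simp
    next
      case False
      then have "J ?U n = inverse z * J ?U (n - k)" using J_per[of "n - k"] by simp
      moreover have "J ?U (n - k) = 0" using False k_pos by (intro less) simp
      ultimately show ?thesis by simp
    qed
  qed
  moreover have "\<exists>n. ?U n \<noteq> 0"
  proof -
    obtain i where i: "i < k" "v $ i \<noteq> 0" using v by (metis eq_vecI carrier_vecD index_zero_vec)
    then have "?U (Suc i) \<noteq> 0" by (simp add: bloch_ext_def)
    then show ?thesis by blast
  qed
  ultimately show ?thesis using per by (simp add: bloch_def)
qed

lemma bloch_imp_ker:
  assumes U: "bloch (inverse z) U" and z: "z \<noteq> 0"
  defines "v \<equiv> vec k (\<lambda>i. U (Suc i))"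
  shows "v \<in> carrier_vec k" "v \<noteq> 0\<^sub>v k" "(symbol k a b z - lam \<cdot>\<^sub>m 1\<^sub>m k) *\<^sub>v v = 0\<^sub>v k"
proof -
  show v: "v \<in> carrier_vec k" by (simp add: v_def)
  have "U (0 + k) = inverse z * U 0" using U unfolding bloch_def by blast
  then have U0: "U 0 = z * U k" using z by simp
  have ext: "bloch_ext z v = U"
  proof
    fix n
    show "bloch_ext z v n = U n"
    proof (cases n)
      case 0
      then show ?thesis using k_pos U0 by (simp add: bloch_ext_def v_def)
    next
      case (Suc m)
      have "m mod k < k" using k_pos by simp
      moreover have "U (Suc m) = inverse z ^ (m div k) * U (Suc (m mod k))"
        using bloch_power[OF U, of "m div k" "Suc (m mod k)"] by simp
      ultimately show ?thesis by (simp add: Suc bloch_ext_def v_def)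
    qed
  qed
  show "v \<noteq> 0\<^sub>v k"
  proof
    assume "v = 0\<^sub>v k"
    then have "v $ (n mod k) = 0" for n using k_pos by simp
    then have "bloch_ext z v n = 0" for n
      using \<open>v = 0\<^sub>v k\<close> k_pos by (simp add: bloch_ext_def)
    then show False using U unfolding ext by (auto simp: bloch_def)
  qed
  have J0: "J (bloch_ext z v) i = 0" for i using U by (simp add: ext bloch_def)
  show "(symbol k a b z - lam \<cdot>\<^sub>m 1\<^sub>m k) *\<^sub>v v = 0\<^sub>v k"
  proof (rule eq_vecI)
    show "dim_vec ((symbol k a b z - lam \<cdot>\<^sub>m 1\<^sub>m k) *\<^sub>v v) = dim_vec (0\<^sub>v k)"
      by simp
    show "((symbol k a b z - lam \<cdot>\<^sub>m 1\<^sub>m k) *\<^sub>v v) $ i = 0\<^sub>v k $ i" if "i < dim_vec (0\<^sub>v k)" for i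
      using that symbol_row[OF v, of i z] J0 by simp
  qed
qed

lemma det_symbol_eq_0_iff:
  assumes "z \<noteq> 0"
  shows "det (symbol k a b z - lam \<cdot>\<^sub>m 1\<^sub>m k) = 0 \<longleftrightarrow> (\<exists>U. bloch (inverse z) U)"
proof -
  have "symbol k a b z - lam \<cdot>\<^sub>m 1\<^sub>m k \<in> carrier_mat k k" by (intro minus_carrier_mat) simp
  from det_0_iff_vec_prod_zero[OF this] show ?thesis
    using bloch_bloch_ext[OF _ _ assms] bloch_imp_ker[OF _ assms] by blast
qed

lemma det_spectrum_iff: "lam \<in> det_spectrum k a b \<longleftrightarrow> (\<exists>w U. norm w = 1 \<and> bloch w U)"
proof
  assume "lam \<in> det_spectrum k a b"
  then obtain z where z: "norm z = 1" "det (symbol k a b z - lam \<cdot>\<^sub>m 1\<^sub>m k) = 0"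
    by (auto simp: det_spectrum_def)
  then have "z \<noteq> 0" by auto
  then show "\<exists>w U. norm w = 1 \<and> bloch w U"
    using det_symbol_eq_0_iff z by (metis inverse_1 norm_inverse)
next
  assume "\<exists>w U. norm w = 1 \<and> bloch w U"
  then obtain w U where w: "norm w = 1" "bloch w U" by blast
  then have "inverse w \<noteq> 0" "norm (inverse w) = 1" by (auto simp: norm_inverse)
  then show "lam \<in> det_spectrum k a b"
    using det_symbol_eq_0_iff[of "inverse w"] w by (auto simp: det_spectrum_def intro!: exI[of _ "inverse w"])
qed

text \<open>The last component of the kernel vector is \<open>U k = inverse z * U 0\<close>, so its
  vanishing is the boundary condition of the half-line.\<close>

lemma edge_momentum_iff: "edge_momentum k a b lam z \<longleftrightarrow> z \<noteq> 0 \<and> (\<exists>U. bloch (inverse z) U \<and> U 0 = 0)"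
proof (cases "z = 0")
  case False
  show ?thesis
  proof
    assume "edge_momentum k a b lam z"
    then obtain v where v: "v \<in> carrier_vec k" "v \<noteq> 0\<^sub>v k"
      "(symbol k a b z - lam \<cdot>\<^sub>m 1\<^sub>m k) *\<^sub>v v = 0\<^sub>v k" "v $ (k - 1) = 0"
      by (auto simp: edge_momentum_def)
    then show "z \<noteq> 0 \<and> (\<exists>U. bloch (inverse z) U \<and> U 0 = 0)"
      using bloch_bloch_ext[OF v(1,2) False v(3)] False by (auto simp: bloch_ext_def)
  next
    assume "z \<noteq> 0 \<and> (\<exists>U. bloch (inverse z) U \<and> U 0 = 0)"
    then obtain U where U: "bloch (inverse z) U" "U 0 = 0" by blast
    have "U (0 + k) = inverse z * U 0" using U(1) unfolding bloch_def by blast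
    then have "vec k (\<lambda>i. U (Suc i)) $ (k - 1) = 0" using k_pos U(2) by simp
    then show "edge_momentum k a b lam z"
      using bloch_imp_ker[OF U(1) False] False unfolding edge_momentum_def by blast
  qed
qed (simp add: edge_momentum_def)

text \<open>An eigenvector of \<open>B\<^sub>0\<close> is a solution with zeros at both ends of a period, hence one period of a
  Bloch solution.\<close>

lemma spectrum_B0_imp_edge_momentum:
  assumes "lam \<in> spectrum (B0_mat k a b)"
  shows "\<exists>z. edge_momentum k a b lam z"
proof -
  obtain w where w: "w \<in> carrier_vec (k - 1)" "w \<noteq> 0\<^sub>v (k - 1)" "B0_mat k a b *\<^sub>v w = lam \<cdot>\<^sub>v w"
    using assms by (auto simp: spectrum_def eigenvalue_def eigenvector_def B0_mat_def)
  \<comment> \<open>The eigenvector is framed by zeros at 0 and \<open>k\<close>. The zero at 0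
    makes it proportional to \<open>sol 0 1\<close>, and the zero at \<open>k\<close> is then passed
    on to \<open>sol 0 1\<close>.\<close>
  define V where "V = (\<lambda>n. if n = 0 \<or> k \<le> n then 0 else w $ (n - 1))"
  have J0: "J V i = 0" if i: "i < k - 1" for i
  proof -
    have "(\<Sum>j<k - 1. tridiag_entry k a b i j * w $ j) = (B0_mat k a b *\<^sub>v w) $ i"
      using w(1) i by (auto simp: B0_mat_def A0_mat_def scalar_prod_def lessThan_atLeast0 intro!: sum.cong)
    also have "\<dots> = lam * w $ i" using w i by simp
    finally have "(\<Sum>j<k - 1. tridiag_entry k a b i j * w $ j) = lam * w $ i" .
    moreover have "i mod k = i" "(i - 1) mod k = i - 1" "i < k - 1" using i by auto
    ultimately have "a i * w $ i + (if Suc i < k - 1 then b i * w $ Suc i else 0)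
        + (if i = 0 then 0 else b (i - 1) * w $ (i - 1)) = lam * w $ i"
      by (simp only: tridiag_sum)
    moreover have "\<beta> (Suc i) = b i" using i by (simp add: \<beta>_Suc)
    moreover have "\<beta> i = b (i - 1)" if "i \<noteq> 0" using i that by (cases i) (simp_all add: \<beta>_Suc)
    ultimately show ?thesis
      using i by (cases "i = 0"; cases "Suc i < k - 1") (auto simp: J_def V_def \<alpha>_def algebra_simps)
  qed
  have V: "V n = V 1 * sol 0 1 n" if "n \<le> k" for n
    by (rule sol_unique[where N = "k - 1"])
      (use that J0 in \<open>auto simp: J_cmult J_sol V_def simp del: sol.simps(3)\<close>)
  obtain i where i: "i < k - 1" "w $ i \<noteq> 0" using w(1,2) by (metis eq_vecI carrier_vecD index_zero_vec)
  then have "V (Suc i) \<noteq> 0" by (simp add: V_def)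
  then have "V 1 \<noteq> 0" using V[of "Suc i"] i by auto
  moreover have "V k = 0" by (simp add: V_def)
  ultimately have s0: "sol 0 1 k = 0" using V[of k] by simp
  \<comment> \<open>With \<open>sol 0 1 k = 0\<close> the monodromy matrix is triangular, and its
    diagonal entries have product 1.\<close>
  then have nz: "sol 0 1 (Suc k) \<noteq> 0" using monodromy_det by auto
  have "bloch (sol 0 1 (Suc k)) (sol 0 1)" by (rule bloch_solI) (use s0 in simp_all)
  then have "edge_momentum k a b lam (inverse (sol 0 1 (Suc k)))"
    unfolding edge_momentum_iff using nz by (auto intro!: exI[of _ "sol 0 1"])
  then show ?thesis by blast
qed

section \<open>The Toeplitz operator and its Green operator\<close>

abbreviation T :: "ell2 \<Rightarrow> ell2" where "T \<equiv> op_shift (toeplitz_op k a b) lam"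

lemma ell2_nth_T: "ell2_nth (T v) m = J (case_nat 0 (ell2_nth v)) m"
proof -
  have "ell2_nth (toeplitz_op k a b v) m = a (m mod k) * ell2_nth v m + b (m mod k) * ell2_nth v (Suc m)
      + (if m = 0 then 0 else b ((m - 1) mod k) * ell2_nth v (m - 1))"
    using k_pos by (simp add: ell2_nth_toeplitz_op tridiag_entry_suminf)
  then show ?thesis
    by (cases m)
      (simp_all add: op_shift_def minus_ell2.rep_eq scaleC_ell2.rep_eq J_def \<beta>_Suc \<alpha>_def algebra_simps)
qed

lemma norm_J_le:
  assumes "\<And>n. norm (\<alpha> n) \<le> D" "\<And>n. norm (\<beta> n) \<le> D"
  shows "norm (J U n) \<le> D * (norm (U (Suc (Suc n))) + norm (U (Suc n)) + norm (U n))"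
proof -
  have "norm (J U n) \<le> norm (\<beta> (Suc n)) * norm (U (Suc (Suc n))) + norm (\<alpha> n) * norm (U (Suc n))
      + norm (\<beta> n) * norm (U n)"
    unfolding J_def norm_mult[symmetric] by (meson add_mono norm_triangle_ineq order_refl order_trans)
  also have "\<dots> \<le> D * norm (U (Suc (Suc n))) + D * norm (U (Suc n)) + D * norm (U n)"
    by (intro add_mono mult_right_mono assms) auto
  finally show ?thesis by (simp add: algebra_simps)
qed

lemma bounded_clinear_T: "bounded_clinear_ell2 T"
proof -
  obtain D where D: "D \<ge> 0" "\<And>n. norm (\<alpha> n) \<le> D" "\<And>n. norm (\<beta> n) \<le> D"
    using bounded_coeff by blast
  define F where "F = (\<lambda>v m. J (case_nat 0 (ell2_nth v)) m)"
  have "bounded_clinear_ell2 (\<lambda>v. Abs_ell2 (F v))"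
  \<comment> \<open>One factor 3 under the square comes from squaring a sum of three terms, the
    other from three shifted copies of \<open>v\<close>; together they give
    \<open>3 * D\<close>.\<close>
  proof (rule bounded_clinear_ell2I[where K = "3 * D"])
    show "F (v + w) m = F v m + F w m" for v w m
      by (cases m) (simp_all add: F_def J_def plus_ell2.rep_eq algebra_simps)
    show "F (scaleC_ell2 c v) m = c * F v m" for c v m
      by (cases m) (simp_all add: F_def J_def scaleC_ell2.rep_eq algebra_simps)
    show "(\<Sum>m<N. (norm (F v m))\<^sup>2) \<le> (3 * D * norm v)\<^sup>2" for v N
    proof -
      let ?V = "case_nat 0 (ell2_nth v)"
      have S: "(\<Sum>m<M. (norm (?V m))\<^sup>2) \<le> (norm v)\<^sup>2" for M
      proof (cases M)
        case (Suc M')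
        then show ?thesis
          using sum_sq_le_norm_ell2[of v M'] by (simp add: sum.lessThan_Suc_shift del: sum.lessThan_Suc)
      qed simp
      have sq: "(D * (x + y + z))\<^sup>2 \<le> D\<^sup>2 * 3 * (x\<^sup>2 + y\<^sup>2 + z\<^sup>2)" for x y z :: real
      proof -
        have "0 \<le> (x - y)\<^sup>2 + (y - z)\<^sup>2 + (x - z)\<^sup>2" by simp
        then have "(x + y + z)\<^sup>2 \<le> 3 * (x\<^sup>2 + y\<^sup>2 + z\<^sup>2)" by (simp add: power2_eq_square algebra_simps)
        then show ?thesis
          using mult_left_mono[of "(x + y + z)\<^sup>2" "3 * (x\<^sup>2 + y\<^sup>2 + z\<^sup>2)" "D\<^sup>2"]
          by (simp add: power_mult_distrib mult.assoc del: distrib_left_numeral)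
      qed
      have "(norm (F v m))\<^sup>2
          \<le> D\<^sup>2 * 3 * ((norm (?V (Suc (Suc m))))\<^sup>2 + (norm (?V (Suc m)))\<^sup>2 + (norm (?V m))\<^sup>2)" for m
        using order_trans[OF power_mono[OF norm_J_le[OF D(2,3), of ?V m], of 2] sq]
        unfolding F_def by (simp only: norm_ge_zero)
      then have "(\<Sum>m<N. (norm (F v m))\<^sup>2)
          \<le> (\<Sum>m<N. D\<^sup>2 * 3 * ((norm (?V (Suc (Suc m))))\<^sup>2 + (norm (?V (Suc m)))\<^sup>2 + (norm (?V m))\<^sup>2))"
        by (intro sum_mono)
      also have "\<dots> = D\<^sup>2 * 3 * ((\<Sum>m<N. (norm (?V (Suc (Suc m))))\<^sup>2)
          + (\<Sum>m<N. (norm (?V (Suc m)))\<^sup>2) + (\<Sum>m<N. (norm (?V m))\<^sup>2))"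
        by (simp only: sum_distrib_left[symmetric] sum.distrib)
      also have "\<dots> \<le> D\<^sup>2 * 3 * ((norm v)\<^sup>2 + (norm v)\<^sup>2 + (norm v)\<^sup>2)"
      proof (intro mult_left_mono add_mono)
        show "(\<Sum>m<N. (norm (?V m))\<^sup>2) \<le> (norm v)\<^sup>2" by (rule S)
        show "(\<Sum>m<N. (norm (?V (Suc m)))\<^sup>2) \<le> (norm v)\<^sup>2"
          using sum_sq_le_norm_ell2[of v N] by simp
        show "(\<Sum>m<N. (norm (?V (Suc (Suc m))))\<^sup>2) \<le> (norm v)\<^sup>2"
          using sum_sq_le_norm_ell2[of v "Suc N"] zero_le_power2[of "norm (ell2_nth v 0)"]
          unfolding sum.lessThan_Suc_shift nat.case by linarith
      qed simp
      also have "\<dots> = (3 * D * norm v)\<^sup>2" by (simp add: power2_eq_square)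
      finally show ?thesis .
    qed
  qed (use D in simp)
  moreover have "(\<lambda>v. Abs_ell2 (F v)) = T"
    unfolding F_def ell2_nth_T[symmetric, abs_def] by (simp add: ell2_nth_inverse)
  ultimately show ?thesis by simp
qed

text \<open>A kernel vector solves the recurrence with boundary value 0, so its first entry
  determines it. In particular the kernel is at most one-dimensional.\<close>

lemma kernel_initial:
  assumes "T v = 0" "ell2_nth v 0 = 0"
  shows "v = 0"
proof (rule ell2_eqI)
  have J0: "J (case_nat 0 (ell2_nth v)) m = 0" for m
    using assms(1) by (simp add: ell2_nth_T[symmetric] zero_ell2.rep_eq)
  have "case_nat 0 (ell2_nth v) (Suc n) = (\<lambda>_. 0) (Suc n)" for n
    by (rule sol_eqI) (simp_all add: J0 assms(2), simp add: J_def)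
  then show "ell2_nth v n = ell2_nth 0 n" for n
    by (simp add: zero_ell2.rep_eq)
qed

text \<open>Variation of constants. \<open>P\<close> sums from the left with the growing solution
  and is multiplied by \<open>\<phi>\<close>; \<open>Q\<close> sums from the right with the decaying
  one and is multiplied by \<open>\<psi>\<close>. The growth cancels up to the geometric factor in
  the distance of the two indices.\<close>

lemma green_operator:
  assumes J\<phi>: "\<And>n. J \<phi> n = 0" and J\<psi>: "\<And>n. J \<psi> n = 0" and W: "wronskian \<phi> \<psi> 0 \<noteq> 0"
    and \<rho>: "0 < \<rho>" "\<rho> < 1" and C: "C > 0"
    and \<phi>: "\<And>n. norm (\<phi> n) \<le> C * \<rho> ^ n" and \<psi>: "\<And>n. norm (\<psi> n) \<le> C / \<rho> ^ n"
  shows "\<exists>G. bounded_clinear_ell2 G \<and>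
    (\<forall>y. \<exists>c. \<forall>m. J (case_nat (c * \<psi> 0) (ell2_nth (G y))) m = ell2_nth y m)"
proof -
  define W0 where "W0 = wronskian \<phi> \<psi> 0"
  define P where "P = (\<lambda>y m. \<Sum>n<m. \<psi> (Suc n) * ell2_nth y n)"
  define Q where "Q = (\<lambda>y m. \<Sum>n. \<phi> (Suc (n + m)) * ell2_nth y (n + m))"
  define X where "X = (\<lambda>y m. - (\<phi> m * P y m + \<psi> m * Q y m) / W0)"
  define F where "F = (\<lambda>y m. X y (Suc m))"
  \<comment> \<open>Up to constants \<open>q\<close> and \<open>p\<close> dominate
    \<open>\<psi> * Q\<close> and \<open>\<phi> * P\<close> with the growth removed; they obey the
    backward and the forward first-order recursion.\<close>
  define q where "q = (\<lambda>y m. \<Sum>n. \<rho> ^ n * norm (ell2_nth y (n + m)))"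
  define p where "p = (\<lambda>y. rec_nat (norm (ell2_nth y 0)) (\<lambda>n x. \<rho> * x + norm (ell2_nth y (Suc n))))"

  have q_sum: "summable (\<lambda>n. \<rho> ^ n * norm (ell2_nth y (n + m)))" for y m
    by (rule summable_comparison_test'[where N = 0 and g = "\<lambda>n. \<rho> ^ n * norm y"])
      (use \<rho> norm_ell2_nth_le in \<open>auto intro!: summable_mult2 summable_geometric mult_left_mono\<close>)
  have Q_le: "norm (\<phi> (Suc (n + m)) * ell2_nth y (n + m))
      \<le> C * \<rho> ^ Suc m * (\<rho> ^ n * norm (ell2_nth y (n + m)))" for y n m
    using mult_right_mono[OF \<phi>[of "Suc (n + m)"], of "norm (ell2_nth y (n + m))"]
    by (simp add: norm_mult power_add ac_simps)
  have Q_nsum: "summable (\<lambda>n. norm (\<phi> (Suc (n + m)) * ell2_nth y (n + m)))" for y m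
    by (rule summable_comparison_test'[where N = 0, OF summable_mult[OF q_sum, of "C * \<rho> ^ Suc m"]])
      (use Q_le in simp)
  have Q_sum: "summable (\<lambda>n. \<phi> (Suc (n + m)) * ell2_nth y (n + m))" for y m
    by (rule summable_norm_cancel[OF Q_nsum])
  have Q_Suc: "Q y m = \<phi> (Suc m) * ell2_nth y m + Q y (Suc m)" for y m
    using suminf_split_head[OF Q_sum, of m y] by (simp add: Q_def)
  have P_Suc: "P y (Suc m) = P y m + \<psi> (Suc m) * ell2_nth y m" for y m
    by (simp add: P_def)

  have JX: "J (X y) m = ell2_nth y m" for y m
  proof -
    \<comment> \<open>All three values of \<open>X\<close> entering row \<open>m\<close> are written
      with the same \<open>?P\<close> and \<open>?Q\<close>, so that \<open>J \<phi>\<close> and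
      \<open>J \<psi>\<close> split off. Only the value at \<open>m\<close> leaves a remainder,
      which is the Wronskian times \<open>?y\<close>.\<close>
    let ?P = "P y (Suc m)" and ?Q = "Q y (Suc m)" and ?y = "ell2_nth y m"
    have 1: "X y (Suc (Suc m)) = - (\<phi> (Suc (Suc m)) * ?P + \<psi> (Suc (Suc m)) * ?Q) / W0"
      using Q_Suc[of y "Suc m"] by (simp add: X_def P_Suc[of y "Suc m"] algebra_simps)
    have 2: "X y m = - (\<phi> m * ?P + \<psi> m * ?Q) / W0
        + (\<phi> m * \<psi> (Suc m) - \<psi> m * \<phi> (Suc m)) * ?y / W0"
      using W by (simp add: X_def P_Suc Q_Suc[of y m] W0_def field_simps)
    have "J (X y) m = - (?P / W0) * J \<phi> m + - (?Q / W0) * J \<psi> m + wronskian \<phi> \<psi> m * ?y / W0"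
      unfolding J_def 1 2 by (simp add: X_def wronskian_def algebra_simps add_divide_distrib diff_divide_distrib)
    then show ?thesis
      using W wronskian_const[OF J\<phi> J\<psi>, of m] by (simp add: J\<phi> J\<psi> W0_def)
  qed

  have P_bd: "norm (P y (Suc m)) \<le> C * p y m / \<rho> ^ Suc m" for y m
  proof (induction m)
    case 0
    show ?case
      using mult_right_mono[OF \<psi>[of 1], of "norm (ell2_nth y 0)"]
      by (simp add: P_def p_def norm_mult)
  next
    case (Suc m)
    have "norm (P y (Suc (Suc m))) \<le> norm (P y (Suc m)) + norm (\<psi> (Suc (Suc m)) * ell2_nth y (Suc m))"
      unfolding P_Suc[of y "Suc m"] by (rule norm_triangle_ineq)
    also have "\<dots> \<le> C * p y m / \<rho> ^ Suc m + C / \<rho> ^ Suc (Suc m) * norm (ell2_nth y (Suc m))"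
      unfolding norm_mult by (intro add_mono Suc mult_right_mono \<psi>) simp
    also have "\<dots> = C * p y (Suc m) / \<rho> ^ Suc (Suc m)"
      using \<rho> by (simp add: p_def field_simps)
    finally show ?case .
  qed
  have Q_bd: "norm (Q y m) \<le> C * \<rho> ^ Suc m * q y m" for y m
  proof -
    have "norm (Q y m) \<le> (\<Sum>n. norm (\<phi> (Suc (n + m)) * ell2_nth y (n + m)))"
      unfolding Q_def by (rule summable_norm[OF Q_nsum])
    also have "\<dots> \<le> (\<Sum>n. C * \<rho> ^ Suc m * (\<rho> ^ n * norm (ell2_nth y (n + m))))"
      by (intro suminf_le Q_le Q_nsum summable_mult q_sum)
    finally show ?thesis by (simp only: q_def suminf_mult[OF q_sum])
  qed

  have q_nonneg: "0 \<le> q y m" for y m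
    unfolding q_def using \<rho> by (intro suminf_nonneg q_sum) auto
  have q_le: "\<bar>q y m\<bar> \<le> norm y / (1 - \<rho>)" for y m
  proof -
    have "q y m \<le> (\<Sum>n. \<rho> ^ n * norm y)"
      unfolding q_def
      by (intro suminf_le q_sum mult_left_mono norm_ell2_nth_le summable_mult2 summable_geometric)
        (use \<rho> in auto)
    also have "\<dots> = norm y / (1 - \<rho>)"
      using \<rho> by (simp add: suminf_mult2[symmetric] suminf_geometric summable_geometric)
    finally show ?thesis using q_nonneg by simp
  qed
  have q_Suc: "q y m = \<rho> * q y (Suc m) + norm (ell2_nth y m)" for y m
    using suminf_split_head[OF q_sum, of y m] suminf_mult[OF q_sum[of y "Suc m"], of \<rho>]
    by (simp add: q_def mult.assoc)
  have p_sum: "(\<Sum>m<N. (p y m)\<^sup>2) \<le> (norm y)\<^sup>2 / (1 - \<rho>)\<^sup>2" for y N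
    by (rule order_trans[OF sum_sq_forward_recursion[of \<rho> _ "\<lambda>m. norm (ell2_nth y m)"]])
      (use \<rho> sum_sq_le_norm_ell2 in \<open>auto simp: p_def intro!: divide_right_mono\<close>)
  have q_sum_sq: "(\<Sum>m<N. (q y m)\<^sup>2) \<le> (norm y)\<^sup>2 / (1 - \<rho>)\<^sup>2" for y N
    by (rule sum_sq_backward_recursion[OF _ _ q_Suc q_le sum_sq_le_norm_ell2]) (use \<rho> in auto)

  define K where "K = C\<^sup>2 / norm W0"
  have F_bd: "norm (F y m) \<le> K * (p y m + q y (Suc m))" for y m
  proof -
    have "norm (\<phi> (Suc m) * P y (Suc m)) \<le> (C * \<rho> ^ Suc m) * (C * p y m / \<rho> ^ Suc m)"
      unfolding norm_mult using \<rho> C by (intro mult_mono \<phi> P_bd) auto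
    also have "\<dots> = C\<^sup>2 * p y m" using \<rho> by (simp add: power2_eq_square)
    finally have 1: "norm (\<phi> (Suc m) * P y (Suc m)) \<le> C\<^sup>2 * p y m" .
    have "norm (\<psi> (Suc m) * Q y (Suc m)) \<le> (C / \<rho> ^ Suc m) * (C * \<rho> ^ Suc (Suc m) * q y (Suc m))"
      unfolding norm_mult using \<rho> C by (intro mult_mono \<psi> Q_bd) auto
    also have "\<dots> = \<rho> * (C\<^sup>2 * q y (Suc m))" using \<rho> by (simp add: power2_eq_square)
    also have "\<dots> \<le> C\<^sup>2 * q y (Suc m)"
      using \<rho> q_nonneg by (intro mult_left_le_one_le) auto
    finally have 2: "norm (\<psi> (Suc m) * Q y (Suc m)) \<le> C\<^sup>2 * q y (Suc m)" .
    have "norm (\<phi> (Suc m) * P y (Suc m) + \<psi> (Suc m) * Q y (Suc m)) \<le> C\<^sup>2 * (p y m + q y (Suc m))"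
      using norm_triangle_le[OF add_mono[OF 1 2]] by (simp add: algebra_simps)
    from divide_right_mono[OF this, of "norm W0"] show ?thesis
      unfolding F_def X_def K_def norm_divide norm_minus_cancel by simp
  qed
  have G: "(\<Sum>m<N. (norm (F y m))\<^sup>2) \<le> (2 * K / (1 - \<rho>) * norm y)\<^sup>2" for y N
  proof -
    have "(norm (F y m))\<^sup>2 \<le> K\<^sup>2 * (2 * ((p y m)\<^sup>2 + (q y (Suc m))\<^sup>2))" for m
    proof -
      have "(norm (F y m))\<^sup>2 \<le> K\<^sup>2 * (p y m + q y (Suc m))\<^sup>2"
        using power_mono[OF F_bd, of y m 2] by (simp add: power_mult_distrib)
      moreover have "(p y m + q y (Suc m))\<^sup>2 \<le> 2 * ((p y m)\<^sup>2 + (q y (Suc m))\<^sup>2)"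
        using zero_le_power2[of "p y m - q y (Suc m)"] by (simp add: power2_eq_square algebra_simps)
      ultimately show ?thesis using mult_left_mono order_trans zero_le_power2 by blast
    qed
    then have "(\<Sum>m<N. (norm (F y m))\<^sup>2) \<le> (\<Sum>m<N. K\<^sup>2 * (2 * ((p y m)\<^sup>2 + (q y (Suc m))\<^sup>2)))"
      by (intro sum_mono)
    also have "\<dots> = K\<^sup>2 * (2 * ((\<Sum>m<N. (p y m)\<^sup>2) + (\<Sum>m<N. (q y (Suc m))\<^sup>2)))"
      by (simp only: sum_distrib_left[symmetric] sum.distrib)
    also have "\<dots> \<le> K\<^sup>2 * (2 * ((norm y)\<^sup>2 / (1 - \<rho>)\<^sup>2 + (norm y)\<^sup>2 / (1 - \<rho>)\<^sup>2))"
    proof (intro mult_left_mono add_mono p_sum)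
      show "(\<Sum>m<N. (q y (Suc m))\<^sup>2) \<le> (norm y)\<^sup>2 / (1 - \<rho>)\<^sup>2"
        using q_sum_sq[of y "Suc N"] zero_le_power2[of "q y 0"]
        unfolding sum.lessThan_Suc_shift by linarith
    qed auto
    also have "\<dots> = (2 * K / (1 - \<rho>) * norm y)\<^sup>2"
      by (simp add: power_mult_distrib power_divide)
    finally show ?thesis .
  qed

  have P_lin: "P (v + w) m = P v m + P w m" "P (scaleC_ell2 c v) m = c * P v m" for v w c m
    by (simp_all add: P_def plus_ell2.rep_eq scaleC_ell2.rep_eq algebra_simps sum.distrib sum_distrib_left)
  have Q_add: "Q (v + w) m = Q v m + Q w m" for v w m
    using suminf_add[OF Q_sum Q_sum, of m v m w]
    by (simp add: Q_def plus_ell2.rep_eq algebra_simps)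
  have Q_scale: "Q (scaleC_ell2 c v) m = c * Q v m" for c v m
    using suminf_mult[OF Q_sum, of c m v]
    by (simp add: Q_def scaleC_ell2.rep_eq mult.left_commute)
  have "bounded_clinear_ell2 (\<lambda>y. Abs_ell2 (F y))"
  proof (rule bounded_clinear_ell2I[OF _ _ G])
    show "F (v + w) m = F v m + F w m" for v w m
      by (simp add: F_def X_def P_lin Q_add algebra_simps add_divide_distrib diff_divide_distrib)
    show "F (scaleC_ell2 c v) m = c * F v m" for c v m
      by (simp add: F_def X_def P_lin Q_scale algebra_simps add_divide_distrib diff_divide_distrib)
    show "0 \<le> 2 * K / (1 - \<rho>)" using \<rho> by (simp add: K_def)
  qed
  moreover have "\<exists>c. \<forall>m. J (case_nat (c * \<psi> 0) (ell2_nth (Abs_ell2 (F y)))) m = ell2_nth y m" for y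
  proof
    \<comment> \<open>\<open>P y 0\<close> is an empty sum, so the boundary value of
      \<open>X y\<close> is a multiple of \<open>\<psi> 0\<close>; this determines
      \<open>c\<close>.\<close>
    have "case_nat (- Q y 0 / W0 * \<psi> 0) (F y) = X y"
      by (rule ext) (auto simp: F_def X_def P_def split: nat.split)
    then show "\<forall>m. J (case_nat (- Q y 0 / W0 * \<psi> 0) (ell2_nth (Abs_ell2 (F y)))) m = ell2_nth y m"
      using ell2_nth_Abs_bounded[OF G] JX by simp
  qed
  ultimately show ?thesis by blast
qed

section \<open>Spectra\<close>

lemma bloch_pair:
  assumes "lam \<notin> det_spectrum k a b"
  shows "\<exists>w \<phi> \<psi>. w \<noteq> 0 \<and> norm w < 1 \<and> bloch w \<phi> \<and> bloch (inverse w) \<psi>"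
proof -
  obtain w U V where w: "w \<noteq> 0" "bloch w U" "bloch (inverse w) V" using bloch_pair_exists by blast
  then have "norm w \<noteq> 1" using assms det_spectrum_iff by blast
  then consider "norm w < 1" | "norm w > 1" by linarith
  then show ?thesis
  proof cases
    case 2
    then have "norm (inverse w) < 1" using w by (simp add: norm_inverse inverse_less_1_iff)
    then show ?thesis using w by (intro exI[of _ "inverse w"] exI[of _ V] exI[of _ U]) auto
  qed (use w in blast)
qed

lemma proportional_of_wronskian_0:
  assumes "bloch w U" "bloch w' V" "wronskian U V 0 = 0"
  shows "\<exists>c\<noteq>0. \<forall>n. V n = c * U n"
proof -
  have "U 0 * V 1 = U 1 * V 0"
    using assms(3) \<beta>_nz[of 0] by (simp add: wronskian_def)
  moreover have "U 0 \<noteq> 0 \<or> U 1 \<noteq> 0" "V 0 \<noteq> 0 \<or> V 1 \<noteq> 0"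
    using assms bloch_initial_nz by blast+
  ultimately have "\<exists>c\<noteq>0. V 0 = c * U 0 \<and> V 1 = c * U 1"
  proof (cases "U 0 = 0")
    case True
    then show ?thesis
      using \<open>U 0 * V 1 = U 1 * V 0\<close> \<open>U 0 \<noteq> 0 \<or> U 1 \<noteq> 0\<close> \<open>V 0 \<noteq> 0 \<or> V 1 \<noteq> 0\<close>
      by (intro exI[of _ "V 1 / U 1"]) auto
  next
    case False
    then show ?thesis
      using \<open>U 0 * V 1 = U 1 * V 0\<close> \<open>V 0 \<noteq> 0 \<or> V 1 \<noteq> 0\<close>
      by (intro exI[of _ "V 0 / U 0"]) (auto simp: field_simps)
  qed
  then obtain c where c: "c \<noteq> 0" "V 0 = c * U 0" "V 1 = c * U 1" by blast
  have "V n = c * U n" for n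
    by (rule sol_eqI[of V "\<lambda>n. c * U n"]) (use assms c in \<open>simp_all add: J_cmult bloch_def\<close>)
  with c(1) show ?thesis by blast
qed

text \<open>Proportional Bloch solutions share their multiplier, and \<open>w = inverse w\<close> is
  incompatible with \<open>norm w < 1\<close>.\<close>

lemma bloch_pair_wronskian:
  assumes "w \<noteq> 0" "norm w < 1" "bloch w \<phi>" "bloch (inverse w) \<psi>"
  shows "wronskian \<phi> \<psi> 0 \<noteq> 0"
proof
  assume "wronskian \<phi> \<psi> 0 = 0"
  then obtain c where c: "c \<noteq> 0" "\<And>n. \<psi> n = c * \<phi> n"
    using proportional_of_wronskian_0 assms by blast
  obtain n where n: "\<phi> n \<noteq> 0" using assms by (auto simp: bloch_def)
  have "\<psi> (n + k) = inverse w * \<psi> n" "\<phi> (n + k) = w * \<phi> n" using assms by (auto simp: bloch_def)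
  then have "inverse w = w" using c n by (auto simp: mult.left_commute)
  then have "norm w * norm w = 1" using assms(1) by (metis norm_mult norm_one right_inverse)
  then show False using assms(2) by (metis abs_norm_cancel less_irrefl abs_square_eq_1 power2_eq_square)
qed

text \<open>Subtracting a multiple of \<open>\<phi>\<close> from \<open>\<psi>\<close> preserves
  both the Wronskian with \<open>\<phi>\<close> and the growth rate. The parameter \<open>d\<close>
  is the freedom to adjust the boundary value.\<close>

lemma green_bloch:
  assumes w: "w \<noteq> 0" "norm w < 1" and \<phi>: "bloch w \<phi>" and \<psi>: "bloch (inverse w) \<psi>"
  shows "\<exists>G. bounded_clinear_ell2 G \<and>
    (\<forall>y. \<exists>c. \<forall>m. J (case_nat (c * (\<psi> 0 - d * \<phi> 0)) (ell2_nth (G y))) m = ell2_nth y m)"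
proof -
  obtain \<rho> where \<rho>: "0 < \<rho>" "\<rho> < 1" "\<rho> ^ k = norm w" using root_exists[OF w] by blast
  obtain A where A: "A > 0" "\<And>n. norm (\<phi> n) \<le> A * \<rho> ^ n"
    using bloch_bound[OF \<phi> \<rho>(1,3)] by blast
  have "inverse \<rho> ^ k = norm (inverse w)" by (simp add: power_inverse \<rho>(3) norm_inverse)
  then obtain B where B: "B > 0" "\<And>n. norm (\<psi> n) \<le> B * inverse \<rho> ^ n"
    using bloch_bound[OF \<psi>, of "inverse \<rho>"] \<rho> by auto
  have \<rho>n: "\<rho> ^ n \<le> 1 / \<rho> ^ n" for n
  proof -
    have "\<rho> ^ n * \<rho> ^ n \<le> 1" using \<rho> by (intro mult_le_one power_le_one) auto
    then show ?thesis using \<rho> by (simp add: pos_le_divide_eq)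
  qed
  define C where "C = A + (B + norm d * A)"
  show ?thesis
  proof (rule green_operator[where \<phi> = \<phi> and \<psi> = "\<lambda>n. \<psi> n - d * \<phi> n" and \<rho> = \<rho> and C = C])
    show "J \<phi> n = 0" for n using \<phi> by (simp add: bloch_def)
    show "J (\<lambda>n. \<psi> n - d * \<phi> n) n = 0" for n
      using J_lincomb[of 1 \<psi> "- d" \<phi> n] \<phi> \<psi> by (simp add: bloch_def)
    show "wronskian \<phi> (\<lambda>n. \<psi> n - d * \<phi> n) 0 \<noteq> 0"
      using bloch_pair_wronskian[OF w \<phi> \<psi>] by (simp add: wronskian_def algebra_simps)
    show "0 < C" using A B by (simp add: C_def add_pos_nonneg)
    have "A \<le> C" using A B by (simp add: C_def)
    then show "norm (\<phi> n) \<le> C * \<rho> ^ n" for n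
      using A(2)[of n] \<rho> by (meson mult_right_mono order_trans zero_le_power less_imp_le)
    show "norm (\<psi> n - d * \<phi> n) \<le> C / \<rho> ^ n" for n
    proof -
      have "norm (\<psi> n - d * \<phi> n) \<le> norm (\<psi> n) + norm d * norm (\<phi> n)"
        by (metis norm_mult norm_triangle_ineq4)
      also have "\<dots> \<le> B * inverse \<rho> ^ n + norm d * (A * \<rho> ^ n)"
        by (intro add_mono B mult_left_mono A) simp
      also have "\<dots> \<le> B * inverse \<rho> ^ n + norm d * (A * (1 / \<rho> ^ n))"
        using A by (intro add_left_mono mult_left_mono \<rho>n) auto
      also have "\<dots> = (B + norm d * A) / \<rho> ^ n"
        by (simp add: power_inverse divide_inverse algebra_simps)
      also have "\<dots> \<le> C / \<rho> ^ n"
        using A \<rho> by (intro divide_right_mono) (auto simp: C_def)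
      finally show ?thesis .
    qed
  qed (use \<rho> in auto)
qed

section \<open>Invertibility and the Fredholm property off the determinantal spectrum\<close>

lemma wronskian_ell2_tendsto_0:
  assumes "w \<noteq> 0" "norm w < 1" "bloch w \<phi>"
  shows "wronskian \<phi> (case_nat 0 (ell2_nth v)) \<longlonglongrightarrow> 0"
proof (rule wronskian_tendsto_0)
  show "\<phi> \<longlonglongrightarrow> 0" using assms bloch_tendsto_0 by blast
  have "Bseq (\<lambda>n. case_nat 0 (ell2_nth v) (Suc n))"
    by (simp add: convergent_imp_Bseq convergentI[OF ell2_nth_tendsto_0])
  then show "Bseq (case_nat 0 (ell2_nth v))" by (simp only: Bseq_Suc_iff)
qed

text \<open>With \<open>d = \<psi> 0 / \<phi> 0\<close> the Green operator respects the boundary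
  condition and is a right inverse. It is also a left inverse because \<open>T\<close> is injective
  and annihilates \<open>G (T v) - v\<close>.\<close>

lemma invertible_T:
  assumes w: "w \<noteq> 0" "norm w < 1" "bloch w \<phi>" "bloch (inverse w) \<psi>" and \<phi>0: "\<phi> 0 \<noteq> 0"
  shows "\<exists>S. bounded_clinear_ell2 S \<and> S \<circ> T = id \<and> T \<circ> S = id"
proof -
  obtain G where G: "bounded_clinear_ell2 G"
    "\<forall>y. \<exists>c. \<forall>m. J (case_nat (c * (\<psi> 0 - \<psi> 0 / \<phi> 0 * \<phi> 0)) (ell2_nth (G y))) m = ell2_nth y m"
    using green_bloch[OF w] by blast
  have TG: "T (G y) = y" for y
    using G(2) \<phi>0 by (intro ell2_eqI) (simp add: ell2_nth_T)
  have inj: "v = 0" if "T v = 0" for v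
  proof -
    let ?V = "case_nat 0 (ell2_nth v)"
    have "J ?V n = 0" for n
      using that by (simp add: ell2_nth_T[symmetric] zero_ell2.rep_eq)
    then have "wronskian \<phi> ?V = (\<lambda>_. wronskian \<phi> ?V 0)"
      using wronskian_const[of \<phi> ?V] w(3) by (auto simp: bloch_def)
    then have "(\<lambda>_. wronskian \<phi> ?V 0) \<longlonglongrightarrow> 0" using wronskian_ell2_tendsto_0[OF w(1-3)] by metis
    then have "wronskian \<phi> ?V 0 = 0" by (simp add: LIMSEQ_const_iff)
    then have "ell2_nth v 0 = 0" using \<beta>_nz \<phi>0 by (simp add: wronskian_def)
    then show ?thesis using kernel_initial that by blast
  qed
  have "G (T v) = v" for v
    using inj[of "G (T v) - v"] by (simp add: bounded_clinear_ell2_diff[OF bounded_clinear_T] TG)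
  then show ?thesis using G(1) TG by (intro exI[of _ G]) (auto simp: fun_eq_iff)
qed

lemma fin_dim_kernel: "fin_dim_ell2 {v. T v = 0}"
proof (cases "\<exists>v. T v = 0 \<and> v \<noteq> 0")
  case True
  then obtain u where u: "T u = 0" "u \<noteq> 0" by blast
  then have u0: "ell2_nth u 0 \<noteq> 0" using kernel_initial by blast
  have sc: "T (scaleC_ell2 c u) = 0" for c
    using bounded_clinear_T u(1) by (simp add: bounded_clinear_ell2_def)
  have "v = scaleC_ell2 (ell2_nth v 0 / ell2_nth u 0) u" if "T v = 0" for v
  proof -
    let ?c = "ell2_nth v 0 / ell2_nth u 0"
    have "T (v - scaleC_ell2 ?c u) = 0"
      by (simp add: bounded_clinear_ell2_diff[OF bounded_clinear_T] sc that)
    moreover have "ell2_nth (v - scaleC_ell2 ?c u) 0 = 0"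
      using u0 by (simp add: minus_ell2.rep_eq scaleC_ell2.rep_eq)
    ultimately have "v - scaleC_ell2 ?c u = 0" by (rule kernel_initial)
    then show ?thesis by simp
  qed
  then have "{v. T v = 0} = range (\<lambda>c. scaleC_ell2 c u)" using sc by auto
  then show ?thesis
    unfolding fin_dim_ell2_def by (intro exI[of _ "{u}"]) (simp add: ell2.span_singleton)
next
  case False
  have "T 0 = 0" using bounded_clinear_ell2_diff[OF bounded_clinear_T, of 0 0] by simp
  then have "{v. T v = 0} = {0}" using False by blast
  then show ?thesis unfolding fin_dim_ell2_def by (intro exI[of _ "{}"]) simp
qed

text \<open>If the decaying solution satisfies the boundary condition, \<open>T\<close> composed with the Green operator
  differs from the identity by a rank one operator with range spanned by the first unit vector,
  which is not in the range of \<open>T\<close>. Hence the range of \<open>T\<close> is the fixed space of the composition.\<close>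

lemma fredholm_T_of_edge:
  assumes w: "w \<noteq> 0" "norm w < 1" "bloch w \<phi>" "bloch (inverse w) \<psi>" and \<phi>0: "\<phi> 0 = 0"
  shows "fredholm T"
proof -
  note diff = bounded_clinear_ell2_diff[OF bounded_clinear_T]
  define e where "e = Abs_ell2 (\<lambda>n. if n = 0 then 1 else 0)"
  have e: "ell2_nth e n = (if n = 0 then 1 else 0)" for n
    unfolding e_def by (subst ell2_nth_Abs_finite) auto
  obtain G where G: "bounded_clinear_ell2 G"
    "\<forall>y. \<exists>c. \<forall>m. J (case_nat (c * (\<psi> 0 - 0 * \<phi> 0)) (ell2_nth (G y))) m = ell2_nth y m"
    using green_bloch[OF w] by blast
  have TG: "\<exists>c. y - T (G y) = scaleC_ell2 c e" for y
  proof -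
    obtain c where c: "\<And>m. J (case_nat (c * \<psi> 0) (ell2_nth (G y))) m = ell2_nth y m"
      using G(2) by fastforce
    \<comment> \<open>Replacing the boundary value \<open>c * \<psi> 0\<close> by 0 changes only row
      0, by its product with \<open>\<beta> 0\<close>.\<close>
    have "ell2_nth (y - T (G y)) m = ell2_nth (scaleC_ell2 (\<beta> 0 * (c * \<psi> 0)) e) m" for m
      unfolding minus_ell2.rep_eq scaleC_ell2.rep_eq e ell2_nth_T c[symmetric]
      by (cases m) (simp_all add: J_def)
    then show ?thesis using ell2_eqI by blast
  qed
  have e_range: "c = 0" if c: "scaleC_ell2 c e = T v" for c v
  proof -
    let ?V = "case_nat 0 (ell2_nth v)"
    have JV: "J ?V m = (if m = 0 then c else 0)" for m
      by (simp add: ell2_nth_T[symmetric] c[symmetric] scaleC_ell2.rep_eq e)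
    have step: "wronskian \<phi> ?V (Suc n) = wronskian \<phi> ?V n + \<phi> (Suc n) * J ?V n" for n
      using w(3) by (intro wronskian_Suc) (simp add: bloch_def)
    \<comment> \<open>Both sequences vanish at 0, so the Wronskian starts at 0, jumps by
      \<open>\<phi> 1 * c\<close> in row 0 and stays constant; its limit 0 forces the jump to
      vanish.\<close>
    have "wronskian \<phi> ?V (Suc n) = \<phi> 1 * c" for n
    proof (induction n)
      case 0
      then show ?case using step[of 0] by (simp add: JV) (simp add: wronskian_def \<phi>0)
    next
      case (Suc n)
      then show ?case using step[of "Suc n"] by (simp add: JV)
    qed
    then have "(\<lambda>n::nat. \<phi> 1 * c) \<longlonglongrightarrow> 0"
      using LIMSEQ_Suc[OF wronskian_ell2_tendsto_0[OF w(1-3), of v]] by simp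
    then have "\<phi> 1 * c = 0" by (simp add: LIMSEQ_const_iff)
    then show ?thesis using bloch_initial_nz[OF w(3)] \<phi>0 by simp
  qed
  have fix_range: "T (G (T v)) = T v" for v
  proof -
    obtain c where c: "T v - T (G (T v)) = scaleC_ell2 c e" using TG by blast
    then have "c = 0" using e_range[of c "v - G (T v)"] by (simp add: diff)
    then show ?thesis using c by simp
  qed
  have "range T = {y. T (G y) = y}"
    using fix_range by (auto intro: rangeI) (metis rangeI)
  moreover have "closed {y. T (G y) = y}"
  proof (rule closed_Collect_eq)
    show "continuous_on UNIV (\<lambda>y. T (G y))"
      using bounded_clinear_T G(1) unfolding bounded_clinear_ell2_def
      by (intro bounded_linear.continuous_on[OF bounded_linear_compose[of T G]] continuous_on_id) auto
  qed (rule continuous_on_id)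
  moreover have "fin_codim_ell2 (range T)"
    unfolding fin_codim_ell2_def
  proof (intro exI[of _ "{e}"] conjI)
    have "y \<in> ell2_span (range T \<union> {e})" for y
    proof -
      obtain c where "y - T (G y) = scaleC_ell2 c e" using TG by blast
      then have "y = T (G y) + scaleC_ell2 c e" by (simp add: algebra_simps)
      also have "\<dots> \<in> ell2_span (range T \<union> {e})"
        by (intro ell2.span_add ell2.span_scale ell2.span_base) auto
      finally show ?thesis .
    qed
    then show "ell2_span (range T \<union> {e}) = UNIV" by blast
  qed simp
  ultimately show ?thesis
    by (simp add: fredholm_def bounded_clinear_T fin_dim_kernel)
qed

lemma fredholm_T:
  assumes "lam \<notin> det_spectrum k a b"
  shows "fredholm T"
proof -
  obtain w \<phi> \<psi> where w: "w \<noteq> 0" "norm w < 1" "bloch w \<phi>" "bloch (inverse w) \<psi>"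
    using bloch_pair[OF assms] by blast
  show ?thesis
  proof (cases "\<phi> 0 = 0")
    case False
    then obtain S where "T \<circ> S = id" using invertible_T[OF w] by blast
    then have "T (S y) = y" for y by (metis comp_apply id_apply)
    then have "range T = UNIV" by (metis surjI)
    moreover have "fin_codim_ell2 UNIV"
      unfolding fin_codim_ell2_def by (intro exI[of _ "{}"]) simp
    ultimately show ?thesis
      by (simp add: fredholm_def bounded_clinear_T fin_dim_kernel)
  qed (use fredholm_T_of_edge[OF w] in blast)
qed

section \<open>Inclusions between the spectra\<close>

lemma edge_spectrumI:
  assumes "lam \<notin> det_spectrum k a b" and w: "w \<noteq> 0" "norm w < 1" and U: "bloch w U" "U 0 = 0"
  shows "lam \<in> edge_spectrum (toeplitz_op k a b)"
proof -
  obtain \<rho> where \<rho>: "0 < \<rho>" "\<rho> < 1" "\<rho> ^ k = norm w" using root_exists[OF w] by blast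
  obtain C where C: "\<And>n. norm (U n) \<le> C * \<rho> ^ n" using bloch_bound[OF U(1) \<rho>(1,3)] by blast
  define v where "v = Abs_ell2 (\<lambda>n. U (Suc n))"
  have "summable (\<lambda>n. (norm (U (Suc n)))\<^sup>2)"
  proof (rule summable_comparison_test'[where N = 0 and g = "\<lambda>n. (C * \<rho>)\<^sup>2 * (\<rho>\<^sup>2) ^ n"])
    show "summable (\<lambda>n. (C * \<rho>)\<^sup>2 * (\<rho>\<^sup>2) ^ n)"
      using \<rho> by (intro summable_mult summable_geometric) (simp add: power_less_one_iff abs_square_less_1)
    show "norm ((norm (U (Suc n)))\<^sup>2) \<le> (C * \<rho>)\<^sup>2 * (\<rho>\<^sup>2) ^ n" for n
      using power_mono[OF C[of "Suc n"], of 2]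
      by (simp add: power_mult_distrib power_mult[symmetric] ac_simps)
  qed
  then have v: "ell2_nth v n = U (Suc n)" for n
    unfolding v_def by (simp add: Abs_ell2_inverse)
  have V: "case_nat 0 (ell2_nth v) = U"
    by (rule ext) (use U(2) in \<open>auto simp: v split: nat.split\<close>)
  have "T v = 0"
    by (rule ell2_eqI) (use U(1) in \<open>simp add: ell2_nth_T V zero_ell2.rep_eq bloch_def\<close>)
  then have "toeplitz_op k a b v = scaleC_ell2 lam v" by (simp add: op_shift_def)
  moreover have "v \<noteq> 0"
  proof
    assume "v = 0"
    then have "U 1 = 0" using v[of 0] by (simp add: zero_ell2.rep_eq)
    then show False using bloch_initial_nz[OF U(1)] U(2) by blast
  qed
  moreover have "exp_decaying v"
    unfolding exp_decaying_def
    by (rule exI[of _ "C * \<rho>"], rule exI[of _ \<rho>]) (use \<rho> C[of "Suc _"] in \<open>auto simp: v mult.assoc\<close>)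
  ultimately show ?thesis
    using fredholm_T[OF assms(1)] by (auto simp: edge_spectrum_def ess_spectrum_def)
qed

text \<open>The point is that \<open>lam\<close> avoids the determinantal spectrum, so that
  \<open>T\<close> is Fredholm: a Bloch solution with multiplier of modulus 1 would be proportional
  to the decaying \<open>U\<close>, hence decay as well.\<close>

lemma edge_momentum_imp_edge_spectrum:
  assumes "edge_momentum k a b lam z" and z: "norm z > 1"
  shows "lam \<in> edge_spectrum (toeplitz_op k a b)"
proof -
  obtain U where U: "bloch (inverse z) U" "U 0 = 0" and "z \<noteq> 0"
    using assms(1) edge_momentum_iff by blast
  then have w: "inverse z \<noteq> 0" "norm (inverse z) < 1"
    using z by (auto simp: norm_inverse inverse_less_1_iff)
  have "lam \<notin> det_spectrum k a b"
  proof
    assume "lam \<in> det_spectrum k a b"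
    then obtain w' V where V: "norm w' = 1" "bloch w' V" using det_spectrum_iff by blast
    obtain C where "\<And>n. norm (V n) \<le> C * 1 ^ n" using bloch_bound[OF V(2), of 1] V(1) by auto
    then have "Bseq V" by (intro BseqI'[of V C]) simp
    then have "wronskian U V \<longlonglongrightarrow> 0"
      using bloch_tendsto_0[OF U(1) w] wronskian_tendsto_0 by blast
    moreover have "wronskian U V = (\<lambda>_. wronskian U V 0)"
      using wronskian_const[of U V] U(1) V(2) by (auto simp: bloch_def)
    ultimately have "(\<lambda>_. wronskian U V 0) \<longlonglongrightarrow> 0" by metis
    then have "wronskian U V 0 = 0" by (simp add: LIMSEQ_const_iff)
    then obtain c where "\<forall>n. V n = c * U n"
      using proportional_of_wronskian_0[OF U(1) V(2)] by blast
    then have "V = (\<lambda>n. c * U n)" by blast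
    then have "V \<longlonglongrightarrow> 0"
      using tendsto_mult_right_zero[OF bloch_tendsto_0[OF U(1) w], of c] by simp
    then show False using bloch_not_tendsto_0[OF V(2,1)] by blast
  qed
  then show ?thesis using edge_spectrumI[OF _ w U] by blast
qed

lemma edge_spectrum_imp_op_spectrum:
  assumes "lam \<in> edge_spectrum (toeplitz_op k a b)"
  shows "lam \<in> op_spectrum (toeplitz_op k a b)"
proof (rule ccontr)
  assume "lam \<notin> op_spectrum (toeplitz_op k a b)"
  then obtain S where S: "S \<circ> T = id" by (auto simp: op_spectrum_def)
  obtain v where v: "v \<noteq> 0" "T v = 0" using assms by (auto simp: edge_spectrum_def op_shift_def)
  have "T 0 = 0" using bounded_clinear_ell2_diff[OF bounded_clinear_T, of 0 0] by simp
  then have "S (T v) = S (T 0)" using v by simp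
  then show False using S v by (metis comp_apply id_apply)
qed

text \<open>Failure of invertibility forces \<open>\<phi> 0 = 0\<close>, and then
  \<open>\<phi>\<close> itself provides the edge state.\<close>

lemma op_spectrum_imp_edge_spectrum:
  assumes "lam \<in> op_spectrum (toeplitz_op k a b)" "lam \<notin> det_spectrum k a b"
  shows "lam \<in> edge_spectrum (toeplitz_op k a b)"
proof -
  obtain w \<phi> \<psi> where w: "w \<noteq> 0" "norm w < 1" "bloch w \<phi>" "bloch (inverse w) \<psi>"
    using bloch_pair[OF assms(2)] by blast
  have "\<phi> 0 = 0"
    using invertible_T[OF w] assms(1) by (auto simp: op_spectrum_def)
  then show ?thesis using edge_spectrumI[OF assms(2) w(1-3)] by blast
qed

text \<open>The truncations of a bounded Bloch solution have unbounded norm, but \<open>T\<close> maps them to vectors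
  supported on the three boundary sites, whose norm stays bounded.\<close>

lemma det_spectrum_imp_op_spectrum:
  assumes "lam \<in> det_spectrum k a b"
  shows "lam \<in> op_spectrum (toeplitz_op k a b)"
proof (rule ccontr)
  assume "lam \<notin> op_spectrum (toeplitz_op k a b)"
  then obtain S where S: "bounded_clinear_ell2 S" "S \<circ> T = id" by (auto simp: op_spectrum_def)
  obtain K where K: "K > 0" "\<And>x. norm (S x) \<le> norm x * K"
    using S(1) bounded_linear.pos_bounded unfolding bounded_clinear_ell2_def by blast
  obtain w U where w: "norm w = 1" and U: "bloch w U" using assms det_spectrum_iff by blast
  obtain C where "C > 0" "\<And>n. norm (U n) \<le> C * 1 ^ n" using bloch_bound[OF U, of 1] w by auto
  then have C: "C > 0" "\<And>n. norm (U n) \<le> C" by auto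
  obtain D where D: "D \<ge> 0" "\<And>n. norm (\<alpha> n) \<le> D" "\<And>n. norm (\<beta> n) \<le> D"
    using bounded_coeff by blast
  \<comment> \<open>At most three rows survive, each bounded by \<open>D * (C + C + C)\<close>; the
    factor 3 is a crude replacement for the square root of 3.\<close>
  define E where "E = 3 * (D * (C + C + C))"
  have "E \<ge> 0" using C D by (simp add: E_def)
  define v where "v = (\<lambda>N. Abs_ell2 (\<lambda>n. if n < N then U (Suc n) else 0))"
  have v: "ell2_nth (v N) n = (if n < N then U (Suc n) else 0)" for N n
    unfolding v_def by (subst ell2_nth_Abs_finite) auto
  have "norm (T (v N)) \<le> E" for N
  proof (rule norm_ell2_le[OF _ \<open>E \<ge> 0\<close>])
    fix M
    let ?V = "case_nat 0 (ell2_nth (v N))"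
    have V: "?V n = (if 1 \<le> n \<and> n \<le> N then U n else 0)" for n
      by (cases n) (auto simp: v)
    \<comment> \<open>Row \<open>m\<close> involves the indices \<open>m\<close> to
      \<open>m + 2\<close>, while \<open>?V\<close> agrees with \<open>U\<close> on 1 to
      \<open>N\<close> and vanishes elsewhere. Any other row sees values of \<open>U\<close> only,
      up to a row where \<open>J U\<close> vanishes, or zeros only.\<close>
    have zero: "ell2_nth (T (v N)) m = 0" if "m \<notin> {0, N - 1, N}" for m
    proof (cases "m < N")
      case True
      then have "J ?V m = J U m" using that unfolding J_def V by auto
      then show ?thesis using U by (simp add: ell2_nth_T bloch_def)
    next
      case False
      then show ?thesis using that unfolding ell2_nth_T J_def V by auto
    qed
    have VC: "norm (?V n) \<le> C" for n using C by (simp add: V less_imp_le)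
    have le: "(norm (ell2_nth (T (v N)) m))\<^sup>2 \<le> (D * (C + C + C))\<^sup>2" for m
    proof (rule power_mono)
      have "norm (ell2_nth (T (v N)) m) \<le> D * (norm (?V (Suc (Suc m))) + norm (?V (Suc m)) + norm (?V m))"
        unfolding ell2_nth_T by (rule norm_J_le[OF D(2,3)])
      also have "\<dots> \<le> D * (C + C + C)"
        by (intro mult_left_mono add_mono VC D)
      finally show "norm (ell2_nth (T (v N)) m) \<le> D * (C + C + C)" .
    qed simp
    have "(\<Sum>m<M. (norm (ell2_nth (T (v N)) m))\<^sup>2)
        = (\<Sum>m\<in>{..<M} \<inter> {0, N - 1, N}. (norm (ell2_nth (T (v N)) m))\<^sup>2)"
      by (rule sum.mono_neutral_right) (use zero in auto)
    also have "\<dots> \<le> (\<Sum>m\<in>{0, N - 1, N}. (norm (ell2_nth (T (v N)) m))\<^sup>2)"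
      by (rule sum_mono2) auto
    also have "\<dots> \<le> of_nat (card {0, N - 1, N}) * (D * (C + C + C))\<^sup>2"
      by (rule sum_bounded_above) (rule le)
    also have "\<dots> \<le> 3\<^sup>2 * (D * (C + C + C))\<^sup>2"
    proof (rule mult_right_mono)
      have "card {0, N - 1, N} \<le> 3" by (simp add: card_insert_if)
      then show "real (card {0, N - 1, N}) \<le> 3\<^sup>2" by simp
    qed simp
    also have "\<dots> = E\<^sup>2" by (simp add: E_def power_mult_distrib)
    finally show "(\<Sum>m<M. (norm (ell2_nth (T (v N)) m))\<^sup>2) \<le> E\<^sup>2" .
  qed
  then have "norm (v N) \<le> E * K" for N
  proof -
    have "norm (v N) = norm (S (T (v N)))" using S(2) by (metis comp_apply id_apply)
    also have "\<dots> \<le> norm (T (v N)) * K" by (rule K)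
    also have "\<dots> \<le> E * K" using \<open>norm (T (v N)) \<le> E\<close> K by (intro mult_right_mono) auto
    finally show ?thesis .
  qed
  then have "(\<Sum>n<N. (norm (U (Suc n)))\<^sup>2) \<le> (E * K)\<^sup>2" for N
    using sum_sq_le_norm_ell2[of "v N" N] power_mono[of "norm (v N)" "E * K" 2] by (simp add: v)
  from ell2_nth_Abs_bounded[OF this] have "(\<lambda>n. U (Suc n)) \<longlonglongrightarrow> 0"
    using ell2_nth_tendsto_0[of "Abs_ell2 (\<lambda>n. U (Suc n))"] by simp
  then have "U \<longlonglongrightarrow> 0" by (rule LIMSEQ_imp_Suc)
  then show False using bloch_not_tendsto_0[OF U w] by blast
qed

end

theorem theorem2p6:
  fixes k :: nat and a b :: "nat \<Rightarrow> complex"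
  assumes "k \<ge> 1"
    and "\<forall>i<k. b i \<noteq> 0"
  shows "(\<forall>lam \<in> spectrum (B0_mat k a b) - Gamma_set k a b. \<exists>z. edge_momentum k a b lam z)
    \<and> (\<forall>lam \<in> spectrum (B0_mat k a b) - Gamma_set k a b. \<forall>z.
         edge_momentum k a b lam z \<and> cmod z > 1 \<longrightarrow>
           lam \<in> edge_spectrum (toeplitz_op k a b)
           \<and> edge_spectrum (toeplitz_op k a b) \<subseteq> op_spectrum (toeplitz_op k a b))
    \<and> op_spectrum (toeplitz_op k a b) = det_spectrum k a b \<union> edge_spectrum (toeplitz_op k a b)"
proof -
  have loc: "periodic_jacobi k b" using assms by unfold_locales
  note facts = periodic_jacobi.spectrum_B0_imp_edge_momentum[OF loc]
    periodic_jacobi.edge_momentum_imp_edge_spectrum[OF loc]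
    periodic_jacobi.edge_spectrum_imp_op_spectrum[OF loc]
    periodic_jacobi.op_spectrum_imp_edge_spectrum[OF loc]
    periodic_jacobi.det_spectrum_imp_op_spectrum[OF loc]
  show ?thesis using facts by blast
qed

end
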